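(* Let $(R,\mathfrak m,k)$ be a commutative Noetherian local ring and let $M$ be a nonzero finitely generated $R$-module. Then: (i) $R\ltimes M$ is not regular. (ii) If $R\ltimes M$ is a hypersurface, then $M$ is a cyclic $R$-module and $R$ is regular. The converse holds provided $R\ltimes M$ is Cohen-Macaulay; that is, if $R\ltimes M$ is Cohen-Macaulay, $M$ is cyclic and $R$ is regular, then $R\ltimes M$ is a hypersurface.
   Context: For a commutative ring $R$ and an $R$-module $M$, the idealization $R\ltimes M$ is the commutative ring whose additive group is $R\oplus M$, with identity $(1,0)$ and multiplication $(r_1,m_1)(r_2,m_2)=(r_1r_2,\,r_1m_2+r_2m_1)$. If $(R,\mathfrak m,k)$ is Noetherian local and $M$ is finitely generated, then $R\ltimes M$ is a Noetherian local ring with maximal ideal $\mathfrak m\ltimes M$ and residue field $k$. A Noetherian local ring $A$ is called a hypersurface if $\operatorname{edim}(A)-\operatorname{depth}(A)\le 1$, where $\operatorname{edim}(A)$ is the minimal number of generators of the maximal ideal of $A$ (equivalently, the completion of $A$ is a quotient of a regular local ring by a principal ideal). *)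

theory Defs
  imports "HOL-Algebra.Algebra" "HOL-Library.Extended_Nat"
begin

section \<open>Noetherian local rings and their invariants\<close>

text \<open>
  The uniqueness assumption also rules out the zero ring, which has no maximal ideal.
\<close>

locale local_ring = cring +
  assumes unique_maximalideal: "\<exists>!\<mm>. maximalideal \<mm> R"

locale noetherian_local_ring = local_ring + noetherian_ring

definition max_ideal :: "('a, 'c) ring_scheme \<Rightarrow> 'a set" where
  "max_ideal A = (THE \<mm>. maximalideal \<mm> A)"

definition edim :: "('a, 'c) ring_scheme \<Rightarrow> nat" where
  "edim A = (LEAST n. \<exists>S \<subseteq> carrier A. finite S \<and> card S = n \<and> max_ideal A = Idl\<^bsub>A\<^esub> S)"

text \<open>
  The Krull dimension is the supremum of the lengths \<open>n\<close> of strict chains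
  \<open>P 0 \<subset> P 1 \<subset> \<dots> \<subset> P n\<close> of prime ideals, the length being the number of
  inclusions. The supremum is taken in \<open>enat\<close>, so that an unbounded set of lengths
  has a meaningful value.
\<close>

definition krull_dim :: "('a, 'c) ring_scheme \<Rightarrow> enat" where
  "krull_dim A = Sup {enat n |n. \<exists>P :: nat \<Rightarrow> 'a set.
     (\<forall>i\<le>n. primeideal (P i) A) \<and> (\<forall>i<n. P i \<subset> P (Suc i))}"

definition nonzerodivisor :: "('a, 'c) ring_scheme \<Rightarrow> 'a \<Rightarrow> bool" where
  "nonzerodivisor A x \<longleftrightarrow>
     x \<in> carrier A \<and> (\<forall>a \<in> carrier A. x \<otimes>\<^bsub>A\<^esub> a = \<zero>\<^bsub>A\<^esub> \<longrightarrow> a = \<zero>\<^bsub>A\<^esub>)"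

text \<open>
  A sequence \<open>x\<^sub>1, \<dots>, x\<^sub>n\<close> is regular on \<open>A\<close> if the class of each \<open>x\<^sub>i\<close> is a
  nonzerodivisor on \<open>A / (x\<^sub>1, \<dots>, x\<^bsub>i-1\<^esub>)\<close> and \<open>A / (x\<^sub>1, \<dots>, x\<^sub>n)\<close> is not zero.
\<close>

definition regular_sequence :: "('a, 'c) ring_scheme \<Rightarrow> 'a list \<Rightarrow> bool" where
  "regular_sequence A xs \<longleftrightarrow>
     set xs \<subseteq> carrier A \<and>
     (\<forall>i < length xs. nonzerodivisor (A Quot (Idl\<^bsub>A\<^esub> (set (take i xs))))
                        (Idl\<^bsub>A\<^esub> (set (take i xs)) +>\<^bsub>A\<^esub> xs ! i)) \<and>
     Idl\<^bsub>A\<^esub> (set xs) \<noteq> carrier A"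

definition depth :: "('a, 'c) ring_scheme \<Rightarrow> enat" where
  "depth A = Sup {enat (length xs) |xs. set xs \<subseteq> max_ideal A \<and> regular_sequence A xs}"

locale regular_local_ring = noetherian_local_ring +
  assumes edim_eq_krull_dim: "enat (edim R) = krull_dim R"

locale cohen_macaulay_local_ring = noetherian_local_ring +
  assumes depth_eq_krull_dim: "depth R = krull_dim R"

text \<open>
  The inequality \<open>edim R - depth R \<le> 1\<close>, written additively because subtraction on
  \<open>enat\<close> is truncated.
\<close>

locale hypersurface_ring = noetherian_local_ring +
  assumes edim_le_depth: "enat (edim R) \<le> depth R + 1"


section \<open>Modules\<close>

definition gen_submodule ::
    "('a, 'c) ring_scheme \<Rightarrow> ('a, 'b, 'd) module_scheme \<Rightarrow> 'b set \<Rightarrow> 'b set" where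
  "gen_submodule R M S = \<Inter>{N. submodule N R M \<and> S \<subseteq> N}"

definition fin_gen_module ::
    "('a, 'c) ring_scheme \<Rightarrow> ('a, 'b, 'd) module_scheme \<Rightarrow> bool" where
  "fin_gen_module R M \<longleftrightarrow> (\<exists>S \<subseteq> carrier M. finite S \<and> carrier M = gen_submodule R M S)"

definition cyclic_module ::
    "('a, 'c) ring_scheme \<Rightarrow> ('a, 'b, 'd) module_scheme \<Rightarrow> bool" where
  "cyclic_module R M \<longleftrightarrow> (\<exists>x \<in> carrier M. carrier M = gen_submodule R M {x})"


section \<open>Idealization\<close>

text \<open>
  The record of a module contains a multiplication and a unit inherited from the
  record of rings; these carry no meaning for a module and are not used here.
\<close>

definition idealization ::
    "('a, 'c) ring_scheme \<Rightarrow> ('a, 'b, 'd) module_scheme \<Rightarrow> ('a \<times> 'b) ring" where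
  "idealization R M =
     \<lparr>carrier = carrier R \<times> carrier M,
      monoid.mult = (\<lambda>(r\<^sub>1, m\<^sub>1) (r\<^sub>2, m\<^sub>2).
        (r\<^sub>1 \<otimes>\<^bsub>R\<^esub> r\<^sub>2, (r\<^sub>1 \<odot>\<^bsub>M\<^esub> m\<^sub>2) \<oplus>\<^bsub>M\<^esub> (r\<^sub>2 \<odot>\<^bsub>M\<^esub> m\<^sub>1))),
      one = (\<one>\<^bsub>R\<^esub>, \<zero>\<^bsub>M\<^esub>),
      ring.zero = (\<zero>\<^bsub>R\<^esub>, \<zero>\<^bsub>M\<^esub>),
      add = (\<lambda>(r\<^sub>1, m\<^sub>1) (r\<^sub>2, m\<^sub>2). (r\<^sub>1 \<oplus>\<^bsub>R\<^esub> r\<^sub>2, m\<^sub>1 \<oplus>\<^bsub>M\<^esub> m\<^sub>2))\<rparr>"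

lemma (in module) idealization_cring: "cring (idealization R M)"
proof (rule cringI)
  show "abelian_group (idealization R M)"
  proof (rule abelian_groupI)
    fix x assume "x \<in> carrier (idealization R M)"
    then show "\<exists>y\<in>carrier (idealization R M). y \<oplus>\<^bsub>idealization R M\<^esub> x = \<zero>\<^bsub>idealization R M\<^esub>"
      by (intro bexI[of _ "(\<ominus>\<^bsub>R\<^esub> fst x, \<ominus>\<^bsub>M\<^esub> snd x)"])
         (auto simp: idealization_def R.l_neg M.l_neg)
  qed (auto simp: idealization_def R.a_ac M.a_ac)
  show "comm_monoid (idealization R M)"
  proof (rule comm_monoidI)
    fix x y z
    assume "x \<in> carrier (idealization R M)" "y \<in> carrier (idealization R M)"
      "z \<in> carrier (idealization R M)"
    then show "x \<otimes>\<^bsub>idealization R M\<^esub> y \<otimes>\<^bsub>idealization R M\<^esub> z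
             = x \<otimes>\<^bsub>idealization R M\<^esub> (y \<otimes>\<^bsub>idealization R M\<^esub> z)"
      by (auto simp: idealization_def R.m_ac M.a_ac smult_r_distr smult_assoc1[symmetric])
  qed (auto simp: idealization_def R.m_ac M.a_ac)
next
  fix x y z
  assume "x \<in> carrier (idealization R M)" "y \<in> carrier (idealization R M)"
    "z \<in> carrier (idealization R M)"
  then show "(x \<oplus>\<^bsub>idealization R M\<^esub> y) \<otimes>\<^bsub>idealization R M\<^esub> z
      = x \<otimes>\<^bsub>idealization R M\<^esub> z \<oplus>\<^bsub>idealization R M\<^esub> y \<otimes>\<^bsub>idealization R M\<^esub> z"
    by (auto simp: idealization_def R.l_distr M.a_ac smult_l_distr smult_r_distr)
qed

end

theory Submission
  imports Defs
begin

text \<open>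
  The three invariants of \<open>A = R \<ltimes> M\<close> are compared with those of \<open>R\<close>. All primes of \<open>A\<close> contain
  the square-zero ideal \<open>0 \<ltimes> M\<close>, so \<open>dim A = dim R\<close>. A generating set of \<open>\<mm> \<ltimes> M\<close> projects onto
  one of \<open>\<mm>\<close>, and elements \<open>(0, u)\<close> that are independent modulo \<open>\<mm> M\<close> can be exchanged into it
  and are lost under the projection; hence \<open>edim A \<ge> edim R + 1\<close>, and \<open>edim A \<ge> edim R + 2\<close> if \<open>M\<close>
  is not cyclic. Since \<open>depth A \<le> dim A = dim R \<le> edim R\<close>, where the last inequality is Krull's
  height theorem, \<open>A\<close> is not regular, and \<open>edim A \<le> depth A + 1\<close> forces \<open>M\<close> to be cyclic and
  \<open>dim R = edim R\<close>. Conversely, \<open>edim A \<le> edim R + 1\<close> if \<open>M\<close> is cyclic.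
\<close>

subsection \<open>Prime ideals in Noetherian rings\<close>

text \<open>Krull's height theorem is proved without changing the ring: ideals over a fixed ideal
  stand for ideals of a quotient, saturated ideals for those of a localization, and chains of primes
  for heights. Most existence arguments then rest on one principle, that a nonempty family of ideals
  has a maximal member. The exchange likewise works with generating sets of the maximal ideal
  instead of the vector space of that ideal modulo its square. The constants 1 and 2 in the bounds
  for \<open>edim\<close> count exchanges: the first starts from the zero submodule, proper because
  \<open>M\<close> is nonzero, the second from \<open>R u\<close>, proper when \<open>M\<close> is
  not cyclic. For a hypersurface, edim R + 1 <= edim A <= depth A + 1 <= dim R + 1 <= edim R + 1
  consists of equalities. In the converse only depth A could be too small, and the Cohen-Macaulay
  condition excludes this.\<close>

lemma (in cring) idealI_cring:
  assumes "I \<subseteq> carrier R" "\<zero> \<in> I"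
    and add: "\<And>x y. x \<in> I \<Longrightarrow> y \<in> I \<Longrightarrow> x \<oplus> y \<in> I"
    and mult: "\<And>a x. a \<in> carrier R \<Longrightarrow> x \<in> I \<Longrightarrow> a \<otimes> x \<in> I"
  shows "ideal I R"
proof (rule idealI)
  show "ring R" by (rule ring_axioms)
  show "subgroup I (add_monoid R)"
  proof (rule add.subgroupI)
    fix x assume x: "x \<in> I"
    have "(\<ominus> \<one>) \<otimes> x \<in> I"
      using x by (intro mult) auto
    then show "\<ominus> x \<in> I"
      using x assms(1) by (simp add: l_minus subset_iff)
  qed (use assms in auto)
  fix a x assume "a \<in> I" "x \<in> carrier R"
  then show "x \<otimes> a \<in> I" "a \<otimes> x \<in> I"
    using mult[of x a] assms(1) m_comm[of x a] by auto
qed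

text \<open>The Noetherian property puts the union of a nonempty chain of ideals into the chain
  itself, so Zorn's lemma applies to a family with no closure property of its own.\<close>

lemma (in noetherian_ring) exists_maximal_ideal_in:
  assumes "\<F> \<noteq> {}" and "\<And>I. I \<in> \<F> \<Longrightarrow> ideal I R"
  obtains J where "J \<in> \<F>" "\<And>I. I \<in> \<F> \<Longrightarrow> J \<subseteq> I \<Longrightarrow> I = J"
proof -
  have "\<Union>C \<in> \<F>" if "C \<noteq> {}" "subset.chain \<F> C" for C
  proof -
    have "C \<subseteq> \<F>"
      using that(2) by (simp add: subset.chain_def)
    moreover from this have "subset.chain {I. ideal I R} C"
      using that(2) assms(2) by (auto simp: subset.chain_def)
    ultimately show ?thesis
      using ideal_chain_is_trivial[OF that(1)] by blast
  qed
  then have "\<exists>M\<in>\<F>. \<forall>K\<in>\<F>. M \<subseteq> K \<longrightarrow> K = M"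
    by (intro subset_Zorn_nonempty assms(1)) auto
  then show ?thesis
    using that by blast
qed

lemma (in ring) ideal_minus_closed:
  assumes "ideal I R" "a \<in> I" "b \<in> I"
  shows "a \<ominus> b \<in> I"
proof -
  interpret ideal I R by fact
  show ?thesis
    using assms by (simp add: minus_eq)
qed

lemma (in cring) primeideal_one_notin:
  assumes "primeideal P R"
  shows "\<one> \<notin> P"
  using ideal.one_imp_carrier[OF primeideal.axioms(1)[OF assms]] primeideal.I_notcarr[OF assms]
  by auto

lemma (in cring) primeideal_mult_notin:
  assumes "primeideal P R" "a \<in> carrier R - P" "b \<in> carrier R - P"
  shows "a \<otimes> b \<in> carrier R - P"
  using primeideal.I_prime[OF assms(1), of a b] assms(2,3) by auto

text \<open>The localization of \<open>R\<close> at a prime \<open>P\<close> is never formed: its ideals are represented by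
  their contractions to \<open>R\<close>, which are exactly the \<open>P\<close>-saturated ideals.\<close>

definition (in cring) saturated :: "'a set \<Rightarrow> 'a set \<Rightarrow> bool" where
  "saturated P I \<longleftrightarrow> ideal I R \<and> (\<forall>s\<in>carrier R - P. \<forall>r\<in>carrier R. s \<otimes> r \<in> I \<longrightarrow> r \<in> I)"

text \<open>For an ideal \<open>J\<close>, this is the contraction to \<open>R\<close> of the ideal
  generated by \<open>J\<close> and \<open>z\<close> in the localization at \<open>P\<close>;
  \<open>s\<close> is a cleared denominator.\<close>

definition (in cring) sat_add :: "'a set \<Rightarrow> 'a set \<Rightarrow> 'a \<Rightarrow> 'a set" where
  "sat_add P J z = {r \<in> carrier R. \<exists>s\<in>carrier R - P. \<exists>j\<in>J. \<exists>c\<in>carrier R. s \<otimes> r = j \<oplus> c \<otimes> z}"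

context cring
begin

lemma saturatedD:
  assumes "saturated P I"
  shows "ideal I R" "\<And>s r. s \<in> carrier R - P \<Longrightarrow> r \<in> carrier R \<Longrightarrow> s \<otimes> r \<in> I \<Longrightarrow> r \<in> I"
  using assms unfolding saturated_def by auto

text \<open>A smaller prime inverts more elements. This lets contractions from the localization at
  \<open>Q\<close> enter arguments at a larger prime \<open>P\<close>.\<close>

lemma saturated_mono:
  assumes "saturated Q I" "Q \<subseteq> P"
  shows "saturated P I"
  using assms unfolding saturated_def by blast

lemma sat_addI:
  assumes "s \<in> carrier R - P" "r \<in> carrier R" "j \<in> J" "c \<in> carrier R" "s \<otimes> r = j \<oplus> c \<otimes> z"
  shows "r \<in> sat_add P J z"
  using assms unfolding sat_add_def by blast

lemma saturated_sat_add:
  assumes P: "primeideal P R" and J: "ideal J R" and z: "z \<in> carrier R"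
  shows "saturated P (sat_add P J z)"
proof -
  interpret J: ideal J R by (rule J)
  note J.Icarr[simp]
  show ?thesis
    unfolding saturated_def
  proof (intro conjI ballI impI)
    show "ideal (sat_add P J z) R"
    proof (rule idealI_cring)
      show "sat_add P J z \<subseteq> carrier R" by (auto simp: sat_add_def)
      show "\<zero> \<in> sat_add P J z"
        by (rule sat_addI[where s = \<one> and j = \<zero> and c = \<zero>])
          (use z primeideal_one_notin[OF P] in auto)
    next
      fix x y assume "x \<in> sat_add P J z" "y \<in> sat_add P J z"
      then obtain s j c t i d where *: "s \<in> carrier R - P" "j \<in> J" "c \<in> carrier R"
        "s \<otimes> x = j \<oplus> c \<otimes> z" "t \<in> carrier R - P" "i \<in> J" "d \<in> carrier R"
        "t \<otimes> y = i \<oplus> d \<otimes> z" and xy: "x \<in> carrier R" "y \<in> carrier R"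
        unfolding sat_add_def by blast
      have carr: "s \<in> carrier R" "t \<in> carrier R" "j \<in> carrier R" "i \<in> carrier R"
        using * by auto
      have "s \<otimes> t \<otimes> (x \<oplus> y) = t \<otimes> (s \<otimes> x) \<oplus> s \<otimes> (t \<otimes> y)"
        using carr xy by algebra
      also have "\<dots> = (t \<otimes> j \<oplus> s \<otimes> i) \<oplus> (t \<otimes> c \<oplus> s \<otimes> d) \<otimes> z"
        unfolding * using carr z *(3,7) by algebra
      finally show "x \<oplus> y \<in> sat_add P J z"
        by (intro sat_addI[where s = "s \<otimes> t" and j = "t \<otimes> j \<oplus> s \<otimes> i" and c = "t \<otimes> c \<oplus> s \<otimes> d"])
          (use * xy carr primeideal_mult_notin[OF P] J.I_l_closed in auto)
    next
      fix a x assume a: "a \<in> carrier R" and "x \<in> sat_add P J z"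
      then obtain s j c where *: "s \<in> carrier R - P" "j \<in> J" "c \<in> carrier R"
        "s \<otimes> x = j \<oplus> c \<otimes> z" and x: "x \<in> carrier R"
        unfolding sat_add_def by blast
      have carr: "s \<in> carrier R" "j \<in> carrier R" using * by auto
      have "s \<otimes> (a \<otimes> x) = a \<otimes> (s \<otimes> x)"
        using carr a x by algebra
      also have "\<dots> = a \<otimes> j \<oplus> (a \<otimes> c) \<otimes> z"
        unfolding * using carr a z *(3) by algebra
      finally show "a \<otimes> x \<in> sat_add P J z"
        by (intro sat_addI[where s = s and j = "a \<otimes> j" and c = "a \<otimes> c"])
          (use * a x J.I_l_closed in auto)
    qed
  next
    fix s r assume s: "s \<in> carrier R - P" and r: "r \<in> carrier R" and "s \<otimes> r \<in> sat_add P J z"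
    then obtain t j c where *: "t \<in> carrier R - P" "j \<in> J" "c \<in> carrier R"
      "t \<otimes> (s \<otimes> r) = j \<oplus> c \<otimes> z"
      unfolding sat_add_def by blast
    show "r \<in> sat_add P J z"
      by (rule sat_addI[where s = "t \<otimes> s" and j = j and c = c])
        (use * s r primeideal_mult_notin[OF P] in \<open>auto simp: m_assoc\<close>)
  qed
qed

lemma sat_add_upper:
  assumes P: "primeideal P R" and J: "ideal J R" and z: "z \<in> carrier R"
  shows "J \<subseteq> sat_add P J z" "z \<in> sat_add P J z"
proof -
  interpret J: ideal J R by (rule J)
  note [simp] = J.Icarr primeideal_one_notin[OF P]
  show "J \<subseteq> sat_add P J z"
    using z by (auto intro: sat_addI[where s = \<one> and c = \<zero>])
  show "z \<in> sat_add P J z"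
    using z by (auto intro!: sat_addI[where s = \<one> and c = \<one> and j = \<zero>])
qed

text \<open>With \<open>saturated_sat_add\<close> and \<open>sat_add_upper\<close>, this
  characterizes \<open>sat_add P J z\<close> as the least saturated ideal over \<open>J\<close> and
  \<open>z\<close>, so inclusions can be checked on generators.\<close>

lemma sat_add_least:
  assumes "saturated P K" "J \<subseteq> K" "z \<in> K"
  shows "sat_add P J z \<subseteq> K"
proof
  fix r assume "r \<in> sat_add P J z"
  then obtain s j c where *: "s \<in> carrier R - P" "j \<in> J" "c \<in> carrier R"
    "s \<otimes> r = j \<oplus> c \<otimes> z" and r: "r \<in> carrier R"
    unfolding sat_add_def by blast
  interpret K: ideal K R using saturatedD(1)[OF assms(1)] .
  have "s \<otimes> r \<in> K"
    unfolding * using * assms by (auto intro: K.I_l_closed)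
  then show "r \<in> K"
    using saturatedD(2)[OF assms(1) *(1) r] by simp
qed

end

lemma (in cring) genideal_insert_ideal:
  assumes J: "ideal J R" and a: "a \<in> carrier R"
  shows "Idl (insert a J) = {j \<oplus> c \<otimes> a |j c. j \<in> J \<and> c \<in> carrier R}" (is "_ = ?K")
proof
  interpret J: ideal J R by (rule J)
  note J.Icarr[simp]
  have "ideal ?K R"
  proof (rule idealI_cring)
    show "?K \<subseteq> carrier R" using a by auto
    show "\<zero> \<in> ?K" using a by (auto intro!: exI[of _ \<zero>])
  next
    fix x y assume "x \<in> ?K" "y \<in> ?K"
    then obtain j c i d where *: "x = j \<oplus> c \<otimes> a" "y = i \<oplus> d \<otimes> a" "j \<in> J" "i \<in> J"
      and cd: "c \<in> carrier R" "d \<in> carrier R" by blast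
    have "x \<oplus> y = (j \<oplus> i) \<oplus> (c \<oplus> d) \<otimes> a"
      unfolding * using J.Icarr[OF *(3)] J.Icarr[OF *(4)] cd a by algebra
    then show "x \<oplus> y \<in> ?K" using * cd by blast
  next
    fix r x assume r: "r \<in> carrier R" and "x \<in> ?K"
    then obtain j c where *: "x = j \<oplus> c \<otimes> a" "j \<in> J" and c: "c \<in> carrier R" by blast
    have "r \<otimes> x = r \<otimes> j \<oplus> (r \<otimes> c) \<otimes> a"
      unfolding * using J.Icarr[OF *(2)] c r a by algebra
    then show "r \<otimes> x \<in> ?K" using * c r J.I_l_closed by blast
  qed
  moreover have "insert a J \<subseteq> ?K"
  proof -
    have "a = \<zero> \<oplus> \<one> \<otimes> a" "\<And>j. j \<in> J \<Longrightarrow> j = j \<oplus> \<zero> \<otimes> a" using a by auto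
    then show ?thesis using J.zero_closed by blast
  qed
  ultimately show "Idl (insert a J) \<subseteq> ?K" by (rule genideal_minimal)
next
  have sub: "insert a J \<subseteq> carrier R"
    using a ideal.Icarr[OF J] by auto
  interpret I: ideal "Idl (insert a J)" R by (rule genideal_ideal[OF sub])
  show "?K \<subseteq> Idl (insert a J)"
    using genideal_self[OF sub] by (auto intro: I.I_l_closed)
qed

locale noetherian_cring = cring + noetherian_ring

sublocale noetherian_local_ring \<subseteq> noetherian_cring ..

context noetherian_cring
begin

text \<open>An ideal \<open>J\<close> maximal among those over \<open>I\<close> that miss
  \<open>S\<close> is prime: if \<open>a\<close> and \<open>b\<close> lie outside \<open>J\<close>,
  then \<open>J + (a)\<close> and \<open>J + (b)\<close> both meet \<open>S\<close>, and the product
  of two such elements lies in \<open>S\<close>, but also in \<open>J\<close> if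
  \<open>a \<otimes> b\<close> does.\<close>

lemma exists_prime_avoiding:
  assumes I: "ideal I R" and S: "S \<subseteq> carrier R" "\<one> \<in> S" "\<And>a b. a \<in> S \<Longrightarrow> b \<in> S \<Longrightarrow> a \<otimes> b \<in> S"
    and disj: "I \<inter> S = {}"
  obtains Q where "primeideal Q R" "I \<subseteq> Q" "Q \<inter> S = {}"
proof -
  let ?F = "{J. ideal J R \<and> I \<subseteq> J \<and> J \<inter> S = {}}"
  obtain J where J: "J \<in> ?F" and max: "\<And>K. K \<in> ?F \<Longrightarrow> J \<subseteq> K \<Longrightarrow> K = J"
    by (rule exists_maximal_ideal_in[of ?F]) (use I disj in auto)
  interpret J: ideal J R using J by simp
  have meets: "\<exists>j\<in>J. \<exists>c\<in>carrier R. j \<oplus> c \<otimes> a \<in> S" if "a \<in> carrier R" "a \<notin> J" for a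
  proof (rule ccontr)
    assume *: "\<not> ?thesis"
    have sub: "insert a J \<subseteq> carrier R" using that J.Icarr by auto
    have "Idl (insert a J) \<inter> S = {}"
      using * unfolding genideal_insert_ideal[OF J.is_ideal that(1)] by blast
    then have "Idl (insert a J) = J"
      using genideal_ideal[OF sub] genideal_self[OF sub] J by (intro max) auto
    then show False
      using genideal_self[OF sub] that by auto
  qed
  have "primeideal J R"
  proof (rule primeidealI)
    show "ideal J R" "cring R" by (rule J.is_ideal, rule cring_axioms)
    show "carrier R \<noteq> J" using J S by auto
  next
    fix a b assume a: "a \<in> carrier R" and b: "b \<in> carrier R" and ab: "a \<otimes> b \<in> J"
    show "a \<in> J \<or> b \<in> J"
    proof (rule ccontr)
      assume "\<not> ?thesis"
      then have "a \<notin> J" "b \<notin> J" by auto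
      then obtain j c i d where *: "j \<in> J" "c \<in> carrier R" "j \<oplus> c \<otimes> a \<in> S"
        "i \<in> J" "d \<in> carrier R" "i \<oplus> d \<otimes> b \<in> S"
        using meets[OF a] meets[OF b] by blast
      have carr: "j \<in> carrier R" "i \<in> carrier R" using * J.Icarr by auto
      have "(j \<oplus> c \<otimes> a) \<otimes> (i \<oplus> d \<otimes> b) = (i \<oplus> d \<otimes> b) \<otimes> j \<oplus> ((c \<otimes> a) \<otimes> i \<oplus> (c \<otimes> d) \<otimes> (a \<otimes> b))"
        using carr *(2,5) a b by algebra
      also have "\<dots> \<in> J"
        using * carr a b ab by (simp add: J.I_l_closed)
      finally show False
        using S(3)[OF *(3) *(6)] J by blast
    qed
  qed
  then show ?thesis using that J by blast
qed

text \<open>Minimal primes over an ideal consist of zero divisors modulo that ideal.\<close>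

lemma exists_prime_below_nonzerodivisor:
  assumes P: "primeideal P R" and I: "ideal I R" "I \<subseteq> P" and x: "x \<in> P"
    and nzd: "\<And>a. a \<in> carrier R \<Longrightarrow> x \<otimes> a \<in> I \<Longrightarrow> a \<in> I"
  obtains Q where "primeideal Q R" "I \<subseteq> Q" "Q \<subset> P"
proof -
  interpret P: primeideal P R by (rule P)
  have xc: "x \<in> carrier R" using x by (rule P.Icarr)
  \<comment> \<open>A prime that misses this multiplicative set misses all of
    \<open>carrier R - P\<close>, hence lies in \<open>P\<close>, and misses \<open>x\<close>, hence
    differs from \<open>P\<close>. Cancelling powers of \<open>x\<close> shows that \<open>I\<close>
    misses the set.\<close>
  let ?S = "{s \<otimes> x [^] k |s (k::nat). s \<in> carrier R - P}"
  have nzd_pow: "a \<in> I" if "a \<in> carrier R" "x [^] k \<otimes> a \<in> I" for a and k :: nat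
    using that(2)
  proof (induction k)
    case 0
    then show ?case using that(1) by simp
  next
    case (Suc k)
    have "x [^] Suc k \<otimes> a = x \<otimes> (x [^] k \<otimes> a)"
      using xc that(1) by (simp add: m_comm m_lcomm)
    with Suc show ?case
      using nzd[of "x [^] k \<otimes> a"] xc that(1) by simp
  qed
  obtain Q where Q: "primeideal Q R" "I \<subseteq> Q" "Q \<inter> ?S = {}"
  proof (rule exists_prime_avoiding[OF I(1), of ?S])
    show "?S \<subseteq> carrier R" using xc by auto
    show "\<one> \<in> ?S"
      using primeideal_one_notin[OF P] by (auto intro!: exI[of _ \<one>] exI[of _ "0::nat"])
  next
    fix a b assume "a \<in> ?S" "b \<in> ?S"
    then obtain s t and k l :: nat where *: "s \<in> carrier R - P" "t \<in> carrier R - P"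
      "a = s \<otimes> x [^] k" "b = t \<otimes> x [^] l" by blast
    have "a \<otimes> b = (s \<otimes> t) \<otimes> x [^] (k + l)"
      using * xc by (simp add: nat_pow_mult[symmetric] m_ac)
    then show "a \<otimes> b \<in> ?S"
      using primeideal_mult_notin[OF P *(1,2)] by blast
  next
    show "I \<inter> ?S = {}"
    proof (rule ccontr)
      assume "I \<inter> ?S \<noteq> {}"
      then obtain s and k :: nat where *: "s \<in> carrier R - P" "s \<otimes> x [^] k \<in> I" by blast
      then have "s \<in> I"
        using nzd_pow[of s k] xc by (simp add: m_comm)
      then show False using * I by auto
    qed
  qed
  have "s \<in> ?S" if "s \<in> carrier R - P" for s
    using that by (auto intro!: exI[of _ s] exI[of _ "0::nat"])
  moreover have "Q \<subseteq> carrier R"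
    using ideal.Icarr[OF primeideal.axioms(1)[OF Q(1)]] by blast
  ultimately have "Q \<subseteq> P"
    using Q(3) by blast
  moreover have "\<one> \<otimes> x [^] (1::nat) \<in> ?S"
    using primeideal_one_notin[OF P] by blast
  then have "x \<notin> Q"
    using Q(3) xc by auto
  ultimately show ?thesis
    using that Q x by blast
qed

text \<open>This is an associated prime of \<open>R / J\<close>, found as a maximal annihilator of a
  nonzero class. If \<open>a \<otimes> b\<close> kills \<open>z\<close> and \<open>b\<close> does
  not, the annihilator of \<open>b \<otimes> z\<close> contains that of \<open>z\<close>, so equals
  it by maximality, and it contains \<open>a\<close>.\<close>

lemma exists_prime_annihilator:
  assumes J: "ideal J R" "J \<noteq> carrier R"
  obtains z where "z \<in> carrier R - J" "primeideal {r \<in> carrier R. r \<otimes> z \<in> J} R"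
proof -
  interpret J: ideal J R by (rule J)
  define ann where "ann z = {r \<in> carrier R. r \<otimes> z \<in> J}" for z
  have ideal_ann: "ideal (ann z) R" if "z \<in> carrier R" for z
  proof (rule idealI_cring)
    show "ann z \<subseteq> carrier R" "\<zero> \<in> ann z" using that by (auto simp: ann_def)
    show "x \<oplus> y \<in> ann z" if "x \<in> ann z" "y \<in> ann z" for x y
      using that \<open>z \<in> carrier R\<close> by (simp add: ann_def l_distr)
    show "a \<otimes> x \<in> ann z" if "a \<in> carrier R" "x \<in> ann z" for a x
      using that \<open>z \<in> carrier R\<close> J.I_l_closed[of "x \<otimes> z" a] by (simp add: ann_def m_assoc)
  qed
  have J_ne: "carrier R - J \<noteq> {}"
    using J.Icarr J(2) by blast
  obtain A where A: "A \<in> ann ` (carrier R - J)"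
    and max: "\<And>B. B \<in> ann ` (carrier R - J) \<Longrightarrow> A \<subseteq> B \<Longrightarrow> B = A"
    by (rule exists_maximal_ideal_in[of "ann ` (carrier R - J)"]) (use J_ne ideal_ann in auto)
  then obtain z where z: "z \<in> carrier R - J" and A_eq: "A = ann z" by blast
  have "primeideal (ann z) R"
  proof (rule primeidealI)
    show "ideal (ann z) R" "cring R" using ideal_ann z cring_axioms by auto
    have "\<one> \<notin> ann z" using z by (simp add: ann_def)
    then show "carrier R \<noteq> ann z" by auto
  next
    fix a b assume a: "a \<in> carrier R" and b: "b \<in> carrier R" and ab: "a \<otimes> b \<in> ann z"
    show "a \<in> ann z \<or> b \<in> ann z"
    proof (rule disjCI)
      assume "b \<notin> ann z"
      then have bz: "b \<otimes> z \<in> carrier R - J" using b z by (simp add: ann_def)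
      have "ann z \<subseteq> ann (b \<otimes> z)"
      proof
        fix r assume "r \<in> ann z"
        then have r: "r \<in> carrier R" "r \<otimes> z \<in> J" by (auto simp: ann_def)
        have "r \<otimes> (b \<otimes> z) = b \<otimes> (r \<otimes> z)" using r b z by (intro m_lcomm) auto
        then show "r \<in> ann (b \<otimes> z)"
          using r b J.I_l_closed by (simp add: ann_def)
      qed
      then have "ann (b \<otimes> z) = ann z"
        using max bz unfolding A_eq by blast
      moreover have "a \<in> ann (b \<otimes> z)"
        using ab a b z by (simp add: ann_def m_assoc)
      ultimately show "a \<in> ann z" by simp
    qed
  qed
  then show ?thesis using that z unfolding ann_def by blast
qed

end

subsection \<open>Krull's height theorem\<close>

lemma chain_snoc:
  fixes D :: "nat \<Rightarrow> 'a set"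
  assumes "\<forall>i\<le>d. \<Phi> (D i)" "\<forall>i<d. D i \<subset> D (Suc i)" "\<Phi> P" "D d \<subset> P"
  shows "\<forall>i\<le>Suc d. \<Phi> ((D(Suc d := P)) i)"
    "\<forall>i<Suc d. (D(Suc d := P)) i \<subset> (D(Suc d := P)) (Suc i)"
  using assms by (simp_all add: le_Suc_eq less_Suc_eq)

context noetherian_cring
begin

text \<open>If \<open>P\<close> is the only prime between \<open>J\<close> and \<open>P\<close>, then the localization of \<open>R / J\<close> at \<open>P\<close> is
  Artinian.\<close>

lemma saturated_chain_stationary:
  fixes K :: "nat \<Rightarrow> 'a set"
  assumes P: "primeideal P R" and J: "saturated P J"
    and min: "\<And>Q. primeideal Q R \<Longrightarrow> J \<subseteq> Q \<Longrightarrow> Q \<subseteq> P \<Longrightarrow> Q = P"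
    and K: "\<And>n. saturated P (K n)" "\<And>n. J \<subseteq> K n" "\<And>n. K (Suc n) \<subseteq> K n"
  shows "\<exists>n. K n = K (Suc n)"
proof (rule ccontr)
  \<comment> \<open>Noetherian induction on the base ideal: \<open>I\<close> below is a largest
    saturated ideal over \<open>J\<close> above which some chain of saturated ideals descends
    strictly at every step.\<close>
  define good where "good J' K' \<longleftrightarrow> (\<forall>n. saturated P (K' n) \<and> J' \<subseteq> K' n \<and> K' (Suc n) \<subseteq> K' n)"
    for J' and K' :: "nat \<Rightarrow> 'a set"
  let ?F = "{J'. saturated P J' \<and> J \<subseteq> J' \<and> (\<exists>K'. good J' K' \<and> (\<forall>n. K' n \<noteq> K' (Suc n)))}"
  assume "\<nexists>n. K n = K (Suc n)"
  moreover have "good J K" using K by (simp add: good_def)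
  ultimately have "J \<in> ?F" using J by auto
  then obtain I where I: "I \<in> ?F" and max: "\<And>L. L \<in> ?F \<Longrightarrow> I \<subseteq> L \<Longrightarrow> L = I"
    using exists_maximal_ideal_in[of ?F] saturatedD(1) by (metis (mono_tags, lifting) empty_iff mem_Collect_eq)
  then obtain L where L: "\<And>n. saturated P (L n)" "\<And>n. I \<subseteq> L n" "\<And>n. L (Suc n) \<subseteq> L n"
    and L_strict: "\<And>n. L n \<noteq> L (Suc n)" and I_sat: "saturated P I" and "J \<subseteq> I"
    unfolding good_def by blast
  interpret I: ideal I R using saturatedD(1)[OF I_sat] .
  have L_ideal: "ideal (L n) R" for n
    using saturatedD(1)[OF L(1)] .
  have L_sub: "L n \<subseteq> carrier R" for n
    using ideal.Icarr[OF L_ideal] by blast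
  have "I \<noteq> carrier R"
    using L(2)[of 0] L(2)[of 1] L_sub[of 0] L_sub[of 1] L_strict[of 0] by auto
  \<comment> \<open>The class of \<open>z\<close> is a socle element: its annihilator is a prime
    over \<open>J\<close>, lies in \<open>P\<close> because \<open>I\<close> is saturated, and so
    equals \<open>P\<close> by the minimality of \<open>P\<close>.\<close>
  then obtain z where z: "z \<in> carrier R - I" and ann: "primeideal {r \<in> carrier R. r \<otimes> z \<in> I} R"
    using exists_prime_annihilator[OF I.is_ideal] by blast
  have "{r \<in> carrier R. r \<otimes> z \<in> I} \<subseteq> P"
    using saturatedD(2)[OF I_sat, of _ z] z by blast
  moreover have "I \<subseteq> {r \<in> carrier R. r \<otimes> z \<in> I}"
    using z I.I_r_closed I.Icarr by blast
  ultimately have ann_eq: "{r \<in> carrier R. r \<otimes> z \<in> I} = P"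
    using min[OF ann] \<open>J \<subseteq> I\<close> by blast
  have zc: "z \<in> carrier R" using z by simp
  \<comment> \<open>Along a descending chain, membership of \<open>z\<close> changes at most once;
    from \<open>m\<close> on, neighbouring terms agree about \<open>z\<close>.\<close>
  obtain m where m: "\<And>n. n \<ge> m \<Longrightarrow> z \<in> L n \<longleftrightarrow> z \<in> L (Suc n)"
  proof (cases "\<forall>n. z \<in> L n")
    case True
    then show ?thesis using that[of 0] by simp
  next
    case False
    then obtain m where "z \<notin> L m" by blast
    moreover have "L n \<subseteq> L m" if "n \<ge> m" for n
      using that L(3) by (induction n rule: dec_induct) auto
    ultimately show ?thesis using that[of m] le_SucI by blast
  qed
  let ?L = "\<lambda>n. sat_add P (L (m + n)) z"
  \<comment> \<open>Adjoining \<open>z\<close> enlarges \<open>I\<close> strictly, so by the choice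
    of \<open>I\<close> the enlarged chain cannot descend at every step.\<close>
  have "\<exists>n. ?L n = ?L (Suc n)"
  proof (rule ccontr)
    assume "\<nexists>n. ?L n = ?L (Suc n)"
    moreover have "good (sat_add P I z) ?L"
      unfolding good_def
    proof (intro allI conjI)
      fix n
      show "saturated P (?L n)" by (rule saturated_sat_add[OF P L_ideal zc])
      show "sat_add P I z \<subseteq> ?L n"
        using L(2) sat_add_upper[OF P L_ideal zc]
        by (intro sat_add_least saturated_sat_add[OF P L_ideal zc]) blast+
      show "?L (Suc n) \<subseteq> ?L n"
        using L(3) sat_add_upper[OF P L_ideal zc]
        by (intro sat_add_least saturated_sat_add[OF P L_ideal zc]) (simp, blast+)
    qed
    ultimately have "sat_add P I z \<in> ?F"
      using saturated_sat_add[OF P I.is_ideal zc] sat_add_upper(1)[OF P I.is_ideal zc] \<open>J \<subseteq> I\<close> by blast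
    then show False
      using max sat_add_upper[OF P I.is_ideal zc] z by blast
  qed
  then obtain n where n: "?L n = ?L (Suc n)" by blast
  let ?k = "m + n"
  have z_iff: "z \<in> L ?k \<longleftrightarrow> z \<in> L (Suc ?k)" by (rule m) simp
  interpret Lk: ideal "L ?k" R by (rule L_ideal)
  interpret Lsk: ideal "L (Suc ?k)" R by (rule L_ideal)
  have "L ?k \<subseteq> L (Suc ?k)"
  proof
    fix k assume k: "k \<in> L ?k"
    then have "k \<in> sat_add P (L (Suc ?k)) z"
      using n sat_add_upper(1)[OF P L_ideal zc] by auto
    then obtain s j c where *: "s \<in> carrier R - P" "j \<in> L (Suc ?k)" "c \<in> carrier R"
      "s \<otimes> k = j \<oplus> c \<otimes> z" unfolding sat_add_def by blast
    have kc: "k \<in> carrier R" using k by (rule Lk.Icarr)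
    \<comment> \<open>If \<open>z\<close> is in neither term, then \<open>c \<otimes> z\<close> lies
      in the larger one, and saturation forces \<open>c\<close> into \<open>P\<close>, the
      annihilator of \<open>z\<close> modulo \<open>I\<close>. So the repetition in the enlarged
      chain passes back to \<open>L\<close>.\<close>
    have "c \<otimes> z \<in> L (Suc ?k)"
    proof (cases "z \<in> L (Suc ?k)")
      case True
      then show ?thesis using * Lsk.I_l_closed by blast
    next
      case False
      have "c \<otimes> z = s \<otimes> k \<ominus> j"
        unfolding * using Lsk.Icarr[OF *(2)] *(3) zc by algebra
      also have "\<dots> \<in> L ?k"
        using k *(1,2) L(3) by (intro ideal_minus_closed L_ideal Lk.I_l_closed) auto
      finally have "c \<in> P"
        using saturatedD(2)[OF L(1), of c z] *(3) zc False z_iff by blast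
      then show ?thesis
        using ann_eq L(2) by blast
    qed
    then have "s \<otimes> k \<in> L (Suc ?k)"
      unfolding * using * by simp
    then show "k \<in> L (Suc ?k)"
      using saturatedD(2)[OF L(1)] * kc by blast
  qed
  then show False
    using L(3)[of ?k] L_strict[of ?k] by blast
qed

text \<open>Nakayama's lemma for \<open>K / L\<close> over the localization at \<open>P\<close>.\<close>

lemma local_nakayama:
  assumes P: "primeideal P R" and L: "saturated P L" and K: "ideal K R"
    and x: "x \<in> P"
    and eq: "\<And>q. q \<in> K \<Longrightarrow> \<exists>s\<in>carrier R - P. \<exists>l\<in>L. \<exists>r\<in>K. s \<otimes> q = l \<oplus> r \<otimes> x"
  shows "K \<subseteq> L"
proof (rule ccontr)
  assume "\<not> K \<subseteq> L"
  interpret P: primeideal P R by (rule P)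
  interpret K: ideal K R by (rule K)
  have xc: "x \<in> carrier R" using x by (rule P.Icarr)
  \<comment> \<open>A maximal member \<open>I\<close> takes the place of a finite generating set of
    \<open>K\<close>: modulo \<open>I\<close> and after localization, \<open>K\<close> is generated
    by any one \<open>g\<close> in \<open>K\<close> outside \<open>I\<close>.\<close>
  let ?F = "{I. saturated P I \<and> L \<subseteq> I \<and> \<not> K \<subseteq> I}"
  obtain I where I: "I \<in> ?F" and max: "\<And>N. N \<in> ?F \<Longrightarrow> I \<subseteq> N \<Longrightarrow> N = I"
    by (rule exists_maximal_ideal_in[of ?F]) (use L \<open>\<not> K \<subseteq> L\<close> saturatedD(1) in auto)
  then obtain g where g: "g \<in> K" "g \<notin> I" by blast
  have I_sat: "saturated P I" using I by simp
  interpret I: ideal I R using saturatedD(1)[OF I_sat] .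
  have gc: "g \<in> carrier R" using g(1) by (rule K.Icarr)
  have "K \<subseteq> sat_add P I g"
  proof (rule ccontr)
    assume "\<not> ?thesis"
    then have "sat_add P I g \<in> ?F"
      using saturated_sat_add[OF P I.is_ideal gc] sat_add_upper(1)[OF P I.is_ideal gc] I by auto
    then show False
      using max sat_add_upper[OF P I.is_ideal gc] g by blast
  qed
  moreover obtain s l r where s: "s \<in> carrier R - P" "l \<in> L" "r \<in> K" "s \<otimes> g = l \<oplus> r \<otimes> x"
    using eq[OF g(1)] by blast
  ultimately obtain t j c where t: "t \<in> carrier R - P" "j \<in> I" "c \<in> carrier R" "t \<otimes> r = j \<oplus> c \<otimes> g"
    unfolding sat_add_def by blast
  have carr: "s \<in> carrier R" "t \<in> carrier R" "r \<in> carrier R" "j \<in> carrier R" "l \<in> I" "l \<in> carrier R"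
    using s t K.Icarr I.Icarr I by auto
  \<comment> \<open>The factor in front of \<open>g\<close> is outside \<open>P\<close>, since
    \<open>t \<otimes> s\<close> is and \<open>x\<close> lies in \<open>P\<close>. It acts as a unit
    modulo the saturated ideal \<open>I\<close>, which puts \<open>g\<close> into
    \<open>I\<close>.\<close>
  have "(t \<otimes> s \<ominus> c \<otimes> x) \<otimes> g = t \<otimes> (s \<otimes> g) \<ominus> (c \<otimes> g) \<otimes> x"
    using carr xc gc t(3) by algebra
  also have "\<dots> = t \<otimes> l \<oplus> (t \<otimes> r) \<otimes> x \<ominus> (c \<otimes> g) \<otimes> x"
    unfolding s using carr xc gc t(3) by algebra
  also have "\<dots> = t \<otimes> l \<oplus> x \<otimes> j"
    unfolding t using carr xc gc t(3) by algebra
  also have "\<dots> \<in> I"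
    using carr xc t by (intro I.a_closed I.I_l_closed)
  finally have *: "(t \<otimes> s \<ominus> c \<otimes> x) \<otimes> g \<in> I" .
  have "t \<otimes> s \<ominus> c \<otimes> x \<notin> P"
  proof
    assume "t \<otimes> s \<ominus> c \<otimes> x \<in> P"
    then have "t \<otimes> s \<ominus> c \<otimes> x \<oplus> c \<otimes> x \<in> P"
      using x t(3) P.I_l_closed by (intro P.a_closed) auto
    moreover have "t \<otimes> s \<ominus> c \<otimes> x \<oplus> c \<otimes> x = t \<otimes> s"
      using carr xc t(3) by algebra
    ultimately show False
      using primeideal_mult_notin[OF P t(1) s(1)] by simp
  qed
  then have "g \<in> I"
    using saturatedD(2)[OF I_sat _ gc *] carr xc t(3) by auto
  then show False using g by simp
qed

text \<open>Krull's principal ideal theorem, for the ring \<open>R / A\<close>. The symbolic powers of the usual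
  proof are replaced by the contractions of the powers of a single \<open>y \<in> Q - A\<close>.\<close>

lemma principal_ideal_theorem:
  assumes A: "primeideal A R" and Q: "primeideal Q R" and P: "primeideal P R"
    and AQ: "A \<subset> Q" and QP: "Q \<subset> P" and x: "x \<in> P"
  obtains Q' where "primeideal Q' R" "A \<subseteq> Q'" "x \<in> Q'" "Q' \<subset> P"
proof -
  interpret A: primeideal A R by (rule A)
  interpret Q: primeideal Q R by (rule Q)
  interpret P: primeideal P R by (rule P)
  have xc: "x \<in> carrier R" using x by (rule P.Icarr)
  obtain y where y: "y \<in> Q" "y \<notin> A" using AQ by blast
  have yc: "y \<in> carrier R" using y(1) by (rule Q.Icarr)
  \<comment> \<open>Suppose that \<open>P\<close> is minimal over \<open>A\<close> and
    \<open>x\<close>. Then \<open>x\<close> is outside \<open>Q\<close>, and the goal is to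
    contradict the strict inclusion of \<open>A\<close> in \<open>Q\<close>.\<close>
  have False if min: "\<And>Q'. primeideal Q' R \<Longrightarrow> A \<subseteq> Q' \<Longrightarrow> x \<in> Q' \<Longrightarrow> Q' \<subseteq> P \<Longrightarrow> Q' = P"
  proof -
    have xQ: "x \<notin> Q" using min[OF Q] AQ QP by blast
    \<comment> \<open>The contraction of the ideal generated by \<open>A\<close> and the
      \<open>n\<close>-th power of \<open>y\<close> in the localization at \<open>Q\<close>.
      Saturation at \<open>Q\<close> makes \<open>x\<close> a nonzerodivisor modulo each
      \<open>I n\<close>.\<close>
    define I where "I n = sat_add Q A (y [^] n)" for n :: nat
    have I_sat: "saturated Q (I n)" for n
      unfolding I_def using yc by (intro saturated_sat_add Q A.is_ideal) simp
    then have I_ideal: "ideal (I n) R" and I_sat': "saturated P (I n)" for n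
      using saturatedD(1) saturated_mono[OF I_sat, of P] QP by auto
    have A_I: "A \<subseteq> I n" and y_I: "y [^] n \<in> I n" for n
      unfolding I_def using yc sat_add_upper[OF Q A.is_ideal] by auto
    have I_dec: "I (Suc n) \<subseteq> I n" for n
    proof -
      have "y [^] Suc n \<in> I n"
        using ideal.I_r_closed[OF I_ideal y_I yc] by simp
      then show ?thesis
        unfolding I_def[of "Suc n"] by (intro sat_add_least I_sat A_I)
    qed
    let ?K = "\<lambda>n. sat_add P (I n) x"
    have "\<exists>n. ?K n = ?K (Suc n)"
    proof (rule saturated_chain_stationary[OF P saturated_sat_add[OF P A.is_ideal xc]])
      fix Q' assume "primeideal Q' R" "sat_add P A x \<subseteq> Q'" "Q' \<subseteq> P"
      then show "Q' = P" using min sat_add_upper[OF P A.is_ideal xc] by blast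
    next
      fix n
      show "saturated P (?K n)" by (rule saturated_sat_add[OF P I_ideal xc])
      show "sat_add P A x \<subseteq> ?K n"
        using A_I sat_add_upper[OF P I_ideal xc]
        by (intro sat_add_least saturated_sat_add[OF P I_ideal xc]) blast+
      show "?K (Suc n) \<subseteq> ?K n"
        using I_dec sat_add_upper[OF P I_ideal xc]
        by (intro sat_add_least saturated_sat_add[OF P I_ideal xc]) blast+
    qed
    then obtain n where n: "?K n = ?K (Suc n)" by blast
    \<comment> \<open>Stationarity only gives this inclusion after adding multiples of
      \<open>x\<close>. The coefficient of \<open>x\<close> falls into \<open>I n\<close> because
      \<open>x\<close> is outside \<open>Q\<close>, and then Nakayama's lemma removes these
      multiples.\<close>
    have "I n \<subseteq> I (Suc n)"
    proof (rule local_nakayama[OF P I_sat' I_ideal x])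
      fix q assume q: "q \<in> I n"
      then have "q \<in> ?K (Suc n)"
        using n sat_add_upper(1)[OF P I_ideal xc] by blast
      then obtain s j c where *: "s \<in> carrier R - P" "j \<in> I (Suc n)" "c \<in> carrier R"
        "s \<otimes> q = j \<oplus> c \<otimes> x" unfolding sat_add_def by blast
      have carr: "j \<in> carrier R" "q \<in> carrier R"
        using ideal.Icarr[OF I_ideal] * q by auto
      have "x \<otimes> c = s \<otimes> q \<ominus> j"
        unfolding * using carr xc *(3) by algebra
      also have "\<dots> \<in> I n"
        using *(1,2) q I_dec by (intro ideal_minus_closed I_ideal ideal.I_l_closed) auto
      finally have "c \<in> I n"
        using saturatedD(2)[OF I_sat, of x c] xQ xc * by auto
      then show "\<exists>s\<in>carrier R - P. \<exists>l\<in>I (Suc n). \<exists>r\<in>I n. s \<otimes> q = l \<oplus> r \<otimes> x"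
        using * by blast
    qed
    then have "y [^] n \<in> I (Suc n)" using y_I by blast
    \<comment> \<open>Collecting both powers of \<open>y\<close> leaves the factor
      \<open>s \<ominus> c \<otimes> y\<close>, which is outside \<open>A\<close> because
      \<open>y\<close> lies in \<open>Q\<close> and \<open>s\<close> does not. So \<open>A\<close>
      contains a power of \<open>y\<close>, hence \<open>y\<close> itself.\<close>
    then obtain s j c where *: "s \<in> carrier R - Q" "j \<in> A" "c \<in> carrier R"
      "s \<otimes> y [^] n = j \<oplus> c \<otimes> y [^] Suc n" unfolding I_def sat_add_def by blast
    define w where "w = y [^] n"
    have wc: "w \<in> carrier R" using yc by (simp add: w_def)
    have eq: "s \<otimes> w = j \<oplus> c \<otimes> (w \<otimes> y)" using *(4) by (simp add: w_def)
    have carr: "s \<in> carrier R" "j \<in> carrier R" using * A.Icarr by auto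
    have "(s \<ominus> c \<otimes> y) \<otimes> w = s \<otimes> w \<ominus> c \<otimes> (w \<otimes> y)"
      using carr yc wc *(3) by algebra
    also have "\<dots> = j"
      unfolding eq using carr yc wc *(3) by algebra
    finally have "(s \<ominus> c \<otimes> y) \<otimes> w \<in> A" using * by simp
    moreover have "s \<ominus> c \<otimes> y \<notin> A"
    proof
      assume "s \<ominus> c \<otimes> y \<in> A"
      then have "s \<ominus> c \<otimes> y \<oplus> c \<otimes> y \<in> Q"
        using AQ y *(3) Q.I_l_closed by (intro Q.a_closed) auto
      moreover have "s \<ominus> c \<otimes> y \<oplus> c \<otimes> y = s"
        using carr yc *(3) by algebra
      ultimately show False using * by simp
    qed
    ultimately have "w \<in> A"
      using A.I_prime[of "s \<ominus> c \<otimes> y" w] carr yc wc *(3) by auto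
    moreover have "y [^] k \<notin> A" for k :: nat
    proof (induction k)
      case 0
      then show ?case using primeideal_one_notin[OF A] by simp
    next
      case (Suc k)
      then show ?case using A.I_prime[of "y [^] k" y] y yc by auto
    qed
    ultimately show False by (simp add: w_def)
  qed
  then show ?thesis using that by blast
qed

text \<open>Moving \<open>x\<close> from the top prime into the bottom one costs one prime. The
  principal ideal theorem for the top three primes puts \<open>x\<close> into the middle one; the
  induction continues below it, and the old top is appended again.\<close>

lemma prime_chain_shift:
  fixes C :: "nat \<Rightarrow> 'a set"
  assumes "\<And>i. i \<le> Suc d \<Longrightarrow> primeideal (C i) R" "\<And>i. i \<le> d \<Longrightarrow> C i \<subset> C (Suc i)"
    and "x \<in> C (Suc d)"
  shows "\<exists>D. (\<forall>i\<le>d. primeideal (D i) R) \<and> (\<forall>i<d. D i \<subset> D (Suc i)) \<and>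
    D d = C (Suc d) \<and> C 0 \<subseteq> D 0 \<and> x \<in> D 0"
  using assms
proof (induction d arbitrary: C)
  case 0
  then show ?case
    by (intro exI[of _ "\<lambda>_. C 1"]) auto
next
  case (Suc d)
  \<comment> \<open>Strictness above \<open>C d\<close> comes from \<open>x\<close> in the second
    case: \<open>P'\<close> contains it and \<open>C d\<close> does not.\<close>
  obtain P' where P': "primeideal P' R" "C d \<subset> P'" "P' \<subset> C (Suc (Suc d))" "x \<in> P'"
  proof (cases "x \<in> C (Suc d)")
    case True
    then show ?thesis
      using that[of "C (Suc d)"] Suc.prems(1)[of "Suc d"] Suc.prems(2)[of d] Suc.prems(2)[of "Suc d"]
      by simp
  next
    case False
    obtain Q' where "primeideal Q' R" "C d \<subseteq> Q'" "x \<in> Q'" "Q' \<subset> C (Suc (Suc d))"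
      by (rule principal_ideal_theorem[of "C d" "C (Suc d)" "C (Suc (Suc d))" x])
        (use Suc.prems in auto)
    moreover have "x \<notin> C d"
      using False Suc.prems(2)[of d] by auto
    ultimately show ?thesis
      using that[of Q'] by blast
  qed
  let ?C = "C(Suc d := P')"
  have "\<exists>D. (\<forall>i\<le>d. primeideal (D i) R) \<and> (\<forall>i<d. D i \<subset> D (Suc i)) \<and>
    D d = ?C (Suc d) \<and> ?C 0 \<subseteq> D 0 \<and> x \<in> D 0"
  proof (rule Suc.IH)
    show "primeideal (?C i) R" if "i \<le> Suc d" for i
      using chain_snoc(1)[of d "\<lambda>I. primeideal I R" C P'] Suc.prems(1,2) P' that by simp
    show "?C i \<subset> ?C (Suc i)" if "i \<le> d" for i
      using chain_snoc(2)[of d "\<lambda>I. primeideal I R" C P'] Suc.prems(1,2) P' that by simp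
  qed (use P' in simp)
  then obtain D where D: "\<forall>i\<le>d. primeideal (D i) R" "\<forall>i<d. D i \<subset> D (Suc i)"
    "D d = P'" "C 0 \<subseteq> D 0" "x \<in> D 0"
    by auto
  have "D d \<subset> C (Suc (Suc d))" using D(3) P'(3) by simp
  note snoc = chain_snoc[of d "\<lambda>I. primeideal I R", OF D(1,2) Suc.prems(1)[OF order_refl] this]
  show ?case
    by (rule exI[of _ "D(Suc d := C (Suc (Suc d)))"]) (intro conjI snoc, use D in simp_all)
qed

text \<open>The set \<open>Y\<close> replaces passage to a quotient: it records the generators
  already forced into the bottom prime. Each step moves one element from \<open>S\<close> to
  \<open>Y\<close> and shortens the chain by one; once \<open>S\<close> is empty, minimality of the
  top makes bottom and top coincide. Krull's theorem is the case \<open>Y = {}\<close>.\<close>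

theorem height_le_card:
  fixes C :: "nat \<Rightarrow> 'a set"
  assumes "finite S" "\<And>i. i \<le> d \<Longrightarrow> primeideal (C i) R" "\<And>i. i < d \<Longrightarrow> C i \<subset> C (Suc i)"
    and "Y \<subseteq> C 0" "S \<subseteq> C d"
    and "\<And>Q. primeideal Q R \<Longrightarrow> Y \<union> S \<subseteq> Q \<Longrightarrow> Q \<subseteq> C d \<Longrightarrow> Q = C d"
  shows "d \<le> card S"
  using assms
proof (induction S arbitrary: d C Y rule: finite_induct)
  case empty
  have "C 0 \<subseteq> C i" if "i \<le> d" for i
    using that
  proof (induction i)
    case (Suc i)
    then show ?case using empty.prems(2)[of i] by auto
  qed simp
  then have "C 0 = C d"
    using empty.prems(5)[of "C 0"] empty.prems(1)[of 0] empty.prems(3) by auto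
  moreover have "C 0 \<subset> C d" if "d = Suc e" for e
    using \<open>\<And>i. i \<le> d \<Longrightarrow> C 0 \<subseteq> C i\<close>[of e] empty.prems(2)[of e] that by auto
  ultimately show ?case by (cases d) auto
next
  case (insert x S)
  show ?case
  proof (cases d)
    case (Suc e)
    have "\<exists>D. (\<forall>i\<le>e. primeideal (D i) R) \<and> (\<forall>i<e. D i \<subset> D (Suc i)) \<and>
      D e = C (Suc e) \<and> C 0 \<subseteq> D 0 \<and> x \<in> D 0"
      by (rule prime_chain_shift) (use insert.prems Suc in auto)
    then obtain D where D: "\<forall>i\<le>e. primeideal (D i) R" "\<forall>i<e. D i \<subset> D (Suc i)"
      "D e = C d" "C 0 \<subseteq> D 0" "x \<in> D 0"
      using Suc by auto
    have "e \<le> card S"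
      by (rule insert.IH[of e D "insert x Y"]) (use insert.prems D in auto)
    then show ?thesis using Suc insert.hyps by simp
  qed simp
qed

end

subsection \<open>Dimension, depth and embedding dimension\<close>

lemma (in ring) nonzerodivisor_QuotD:
  assumes I: "ideal I R" and x: "x \<in> carrier R" and nzd: "nonzerodivisor (R Quot I) (I +> x)"
    and a: "a \<in> carrier R" "x \<otimes> a \<in> I"
  shows "a \<in> I"
proof -
  interpret I: ideal I R by (rule I)
  have "I +> a \<in> carrier (R Quot I)"
    using a I.a_subset by (simp add: FactRing_def a_rcosetsI)
  moreover have "(I +> x) \<otimes>\<^bsub>R Quot I\<^esub> (I +> a) = \<zero>\<^bsub>R Quot I\<^esub>"
    using a x I.rcoset_mult_add a_rcos_zero[OF I] by (simp add: FactRing_def)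
  ultimately have "I +> a = I"
    using nzd unfolding nonzerodivisor_def by (simp add: FactRing_def)
  then show ?thesis
    using I.rcos_const_imp_mem a by simp
qed

lemma krull_dim_ge:
  assumes "\<And>i. i \<le> n \<Longrightarrow> primeideal (C i) A" "\<And>i. i < n \<Longrightarrow> C i \<subset> C (Suc i)"
  shows "enat n \<le> krull_dim A"
  unfolding krull_dim_def using assms by (intro Sup_upper) auto

text \<open>The chain is built downwards from \<open>P\<close>: the last element is a nonzerodivisor
  modulo the earlier ones, so some prime over the earlier ones lies strictly below
  \<open>P\<close>.\<close>

lemma (in noetherian_cring) prime_chain_of_regular_sequence:
  assumes "set xs \<subseteq> carrier R"
    and "\<And>i. i < length xs \<Longrightarrow> nonzerodivisor (R Quot (Idl (set (take i xs))))
      (Idl (set (take i xs)) +> xs ! i)"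
    and "primeideal P R" "set xs \<subseteq> P"
  shows "\<exists>C. (\<forall>i\<le>length xs. primeideal (C i) R) \<and> (\<forall>i<length xs. C i \<subset> C (Suc i)) \<and>
    C (length xs) = P"
  using assms
proof (induction xs arbitrary: P rule: rev_induct)
  case Nil
  then show ?case by (intro exI[of _ "\<lambda>_. P"]) simp
next
  case (snoc x xs)
  have I: "ideal (Idl (set xs)) R"
    using snoc.prems by (intro genideal_ideal) auto
  have sub: "Idl (set xs) \<subseteq> P"
    using snoc.prems primeideal.axioms(1) by (intro genideal_minimal) auto
  have nzd: "nonzerodivisor (R Quot (Idl (set xs))) (Idl (set xs) +> x)"
    using snoc.prems(2)[of "length xs"] by simp
  obtain Q where Q: "primeideal Q R" "Idl (set xs) \<subseteq> Q" "Q \<subset> P"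
    by (rule exists_prime_below_nonzerodivisor[OF snoc.prems(3) I sub, of x])
      (use snoc.prems nonzerodivisor_QuotD[OF I _ nzd] in auto)
  have "\<exists>C. (\<forall>i\<le>length xs. primeideal (C i) R) \<and> (\<forall>i<length xs. C i \<subset> C (Suc i)) \<and>
    C (length xs) = Q"
  proof (rule snoc.IH)
    fix i assume "i < length xs"
    then show "nonzerodivisor (R Quot (Idl (set (take i xs)))) (Idl (set (take i xs)) +> xs ! i)"
      using snoc.prems(2)[of i] by (simp add: nth_append)
  qed (use snoc.prems Q genideal_self[of "set xs"] in auto)
  then obtain C where C: "\<forall>i\<le>length xs. primeideal (C i) R" "\<forall>i<length xs. C i \<subset> C (Suc i)"
    "C (length xs) = Q" by blast
  have "C (length xs) \<subset> P" using C(3) Q(3) by simp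
  note snoc = chain_snoc[of "length xs" "\<lambda>I. primeideal I R", OF C(1,2) snoc.prems(3) this]
  show ?case
    by (rule exI[of _ "C(Suc (length xs) := P)"]) (use snoc in simp)
qed

theorem (in noetherian_cring) depth_le_krull_dim: "depth R \<le> krull_dim R"
  unfolding depth_def
proof (rule Sup_least, clarify)
  fix xs assume xs: "regular_sequence R xs"
  then have sub: "set xs \<subseteq> carrier R" and proper: "Idl (set xs) \<noteq> carrier R"
    unfolding regular_sequence_def by auto
  have I: "ideal (Idl (set xs)) R" by (rule genideal_ideal[OF sub])
  obtain P where "primeideal P R" "Idl (set xs) \<subseteq> P"
    \<comment> \<open>Missing \<open>{\<one>}\<close> means being proper, which is part of the
      definition of a regular sequence.\<close>
    by (rule exists_prime_avoiding[OF I, of "{\<one>}"])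
      (use proper ideal.one_imp_carrier[OF I] in auto)
  then obtain C where "\<forall>i\<le>length xs. primeideal (C i) R" "\<forall>i<length xs. C i \<subset> C (Suc i)"
    using prime_chain_of_regular_sequence[of xs P] xs genideal_self[OF sub]
    unfolding regular_sequence_def by blast
  then show "enat (length xs) \<le> krull_dim R"
    by (intro krull_dim_ge[of _ C]) auto
qed

lemma (in local_ring) maximalideal_max_ideal: "maximalideal (max_ideal R) R"
  unfolding max_ideal_def using unique_maximalideal by (rule theI')

lemma (in local_ring) max_ideal_eqI: "maximalideal J R \<Longrightarrow> max_ideal R = J"
  unfolding max_ideal_def using unique_maximalideal by (rule the1_equality)

lemma edim_le_card:
  assumes "S \<subseteq> carrier A" "finite S" "max_ideal A = Idl\<^bsub>A\<^esub> S"
  shows "edim A \<le> card S"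
  unfolding edim_def by (rule Least_le) (use assms in auto)

section \<open>Units, dimension bound and exchange of generators in Noetherian local rings\<close>

context noetherian_local_ring
begin

lemma ideal_max_ideal: "ideal (max_ideal R) R"
  using maximalideal.axioms(1)[OF maximalideal_max_ideal] .

lemma primeideal_max_ideal: "primeideal (max_ideal R) R"
  by (rule maximalideal_prime[OF maximalideal_max_ideal])

lemma ideal_subset_max_ideal:
  assumes "ideal I R" "I \<noteq> carrier R"
  shows "I \<subseteq> max_ideal R"
proof -
  let ?F = "{J. ideal J R \<and> I \<subseteq> J \<and> J \<noteq> carrier R}"
  obtain J where J: "J \<in> ?F" and max: "\<And>K. K \<in> ?F \<Longrightarrow> J \<subseteq> K \<Longrightarrow> K = J"
    by (rule exists_maximal_ideal_in[of ?F]) (use assms in auto)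
  have "maximalideal J R"
    by (rule maximalidealI) (use J max in blast)+
  then show ?thesis using max_ideal_eqI J by blast
qed

lemma notin_max_ideal_Units:
  assumes "a \<in> carrier R" "a \<notin> max_ideal R"
  shows "a \<in> Units R"
proof -
  have "PIdl a = carrier R"
    using ideal_subset_max_ideal[OF cgenideal_ideal[OF assms(1)]] cgenideal_self[OF assms(1)] assms(2)
    by blast
  then obtain b where "b \<in> carrier R" "\<one> = b \<otimes> a"
    unfolding cgenideal_def using one_closed by blast
  then show ?thesis
    using assms(1) m_comm[of b a] unfolding Units_def by auto
qed

lemma edim_generators:
  obtains S where "S \<subseteq> carrier R" "finite S" "card S = edim R" "Idl S = max_ideal R"
proof -
  have "\<exists>n. \<exists>S\<subseteq>carrier R. finite S \<and> card S = n \<and> max_ideal R = Idl S"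
    using finetely_gen[OF ideal_max_ideal] by blast
  from LeastI_ex[OF this] show ?thesis
    unfolding edim_def[symmetric] using that by blast
qed

theorem krull_dim_le_edim: "krull_dim R \<le> enat (edim R)"
  unfolding krull_dim_def
proof (rule Sup_least, clarify)
  fix n and C :: "nat \<Rightarrow> 'a set"
  assume C: "\<forall>i\<le>n. primeideal (C i) R" "\<forall>i<n. C i \<subset> C (Suc i)"
  obtain S where S: "S \<subseteq> carrier R" "finite S" "card S = edim R" "Idl S = max_ideal R"
    by (rule edim_generators)
  have "C n \<subseteq> max_ideal R"
    using C(1) ideal_subset_max_ideal[of "C n"] primeideal.axioms(1) primeideal.I_notcarr by blast
  \<comment> \<open>Replacing the top of the chain by the maximal ideal keeps it strict and makes
    the top minimal over the generating set \<open>S\<close>.\<close>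
  have "n \<le> card S"
  proof (rule height_le_card[OF S(2), of n "C(n := max_ideal R)" "{}"])
    show "primeideal ((C(n := max_ideal R)) i) R" if "i \<le> n" for i
      using that C(1) primeideal_max_ideal by simp
    show "(C(n := max_ideal R)) i \<subset> (C(n := max_ideal R)) (Suc i)" if "i < n" for i
      using that C(2) \<open>C n \<subseteq> max_ideal R\<close> by (cases "Suc i = n") auto
    show "S \<subseteq> (C(n := max_ideal R)) n"
      using genideal_self[OF S(1)] S(4) by simp
    show "Q = (C(n := max_ideal R)) n"
      if "primeideal Q R" "{} \<union> S \<subseteq> Q" "Q \<subseteq> (C(n := max_ideal R)) n" for Q
      using that genideal_minimal[OF primeideal.axioms(1)[OF that(1)], of S] S(4) by simp
  qed simp
  then show "enat n \<le> enat (edim R)" using S by simp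
qed

text \<open>Steinitz exchange modulo \<open>Q\<close>. If every coefficient of \<open>x\<close> at
  \<open>S\<close> were in the maximal ideal, then \<open>x\<close> would lie in \<open>Q\<close>;
  so some coefficient is a unit and its generator can be solved for. A term with nonunit coefficient
  is subtracted, which leaves the rest outside \<open>Q\<close>. Since \<open>T\<close> lies in
  \<open>Q\<close>, it is never exchanged.\<close>

lemma exists_exchange:
  assumes "finite S" and Q: "ideal Q R"
    and mm: "\<And>a b. a \<in> max_ideal R \<Longrightarrow> b \<in> max_ideal R \<Longrightarrow> a \<otimes> b \<in> Q"
    and "S \<subseteq> max_ideal R" "T \<subseteq> Q" "x \<in> Idl (T \<union> S)" "x \<notin> Q"
  shows "\<exists>s\<in>S. s \<in> Idl (insert x (T \<union> (S - {s})))"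
  using assms(1,4-)
proof (induction S arbitrary: x rule: finite_induct)
  case empty
  then show ?case using genideal_minimal[OF Q, of T] by auto
next
  case (insert s S)
  interpret m: ideal "max_ideal R" R by (rule ideal_max_ideal)
  interpret Q: ideal Q R by (rule Q)
  have sub: "T \<union> S \<subseteq> carrier R" and s: "s \<in> carrier R"
    using insert.prems Q.Icarr m.Icarr by auto
  interpret I: ideal "Idl (T \<union> S)" R by (rule genideal_ideal[OF sub])
  have sub': "insert s (Idl (T \<union> S)) \<subseteq> carrier R" using s I.Icarr by auto
  have "Idl (T \<union> insert s S) \<subseteq> Idl (insert s (Idl (T \<union> S)))"
    using genideal_self[OF sub] genideal_self[OF sub'] by (intro genideal_minimal genideal_ideal[OF sub']) auto
  then obtain y c where x_eq: "x = y \<oplus> c \<otimes> s" and y: "y \<in> Idl (T \<union> S)" and c: "c \<in> carrier R"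
    using insert.prems(3) unfolding genideal_insert_ideal[OF I.is_ideal s] by blast
  have yc: "y \<in> carrier R" using y by (rule I.Icarr)
  have xc: "x \<in> carrier R" unfolding x_eq using yc c s by simp
  show ?case
  proof (cases "c \<in> max_ideal R")
    case True
    then have cs: "c \<otimes> s \<in> Q" using mm insert.prems(1) by simp
    then have "y \<notin> Q" using insert.prems(4) unfolding x_eq by auto
    then obtain s' where s': "s' \<in> S" "s' \<in> Idl (insert y (T \<union> (S - {s'})))"
      using insert.IH[of y] insert.prems y by auto
    let ?G = "insert x (T \<union> (insert s S - {s'}))"
    have G: "?G \<subseteq> carrier R" using sub s xc by auto
    interpret G: ideal "Idl ?G" R by (rule genideal_ideal[OF G])
    have "s \<in> Idl ?G" "x \<in> Idl ?G"
      using genideal_self[OF G] s' insert.hyps by auto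
    then have "x \<ominus> c \<otimes> s \<in> Idl ?G"
      using c by (intro ideal_minus_closed G.is_ideal G.I_l_closed)
    moreover have "x \<ominus> c \<otimes> s = y"
      unfolding x_eq using yc c s by algebra
    ultimately have "Idl (insert y (T \<union> (S - {s'}))) \<subseteq> Idl ?G"
      using genideal_self[OF G] by (intro genideal_minimal G.is_ideal) auto
    then show ?thesis using s' by blast
  next
    case False
    then have cU: "c \<in> Units R" using notin_max_ideal_Units c by blast
    let ?G = "insert x (T \<union> (insert s S - {s}))"
    have G: "?G \<subseteq> carrier R" using sub s xc by auto
    interpret G: ideal "Idl ?G" R by (rule genideal_ideal[OF G])
    have "Idl (T \<union> S) \<subseteq> Idl ?G"
      using genideal_self[OF G] insert.hyps by (intro genideal_minimal G.is_ideal) auto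
    then have "inv c \<otimes> (x \<ominus> y) \<in> Idl ?G"
      using genideal_self[OF G] y cU by (intro ideal_minus_closed G.is_ideal G.I_l_closed) auto
    moreover have "x \<ominus> y = c \<otimes> s"
      unfolding x_eq using yc c s by algebra
    then have "inv c \<otimes> (x \<ominus> y) = s"
      using cU c s by (simp add: m_assoc[symmetric])
    ultimately show ?thesis by auto
  qed
qed

lemma max_ideal_exchange:
  assumes S: "finite S" and gen: "T \<union> S \<subseteq> carrier R" "Idl (T \<union> S) = max_ideal R"
    and Q: "ideal Q R" "\<And>a b. a \<in> max_ideal R \<Longrightarrow> b \<in> max_ideal R \<Longrightarrow> a \<otimes> b \<in> Q"
    and "T \<subseteq> Q" "x \<in> max_ideal R" "x \<notin> Q"
  obtains s where "s \<in> S" "Idl (insert x T \<union> (S - {s})) = max_ideal R"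
proof -
  have gm: "T \<union> S \<subseteq> max_ideal R"
    using genideal_self[OF gen(1)] gen(2) by simp
  obtain s where s: "s \<in> S" "s \<in> Idl (insert x T \<union> (S - {s}))"
    using exists_exchange[OF S Q, of T x] assms gm by auto
  let ?G = "insert x T \<union> (S - {s})"
  have G: "?G \<subseteq> carrier R"
    using gen(1) assms(7) ideal.Icarr[OF ideal_max_ideal] by auto
  have "Idl (T \<union> S) \<subseteq> Idl ?G"
    using genideal_self[OF G] s by (intro genideal_minimal genideal_ideal[OF G]) auto
  moreover have "Idl ?G \<subseteq> max_ideal R"
    using gm assms(7) by (intro genideal_minimal ideal_max_ideal) auto
  ultimately show ?thesis using that s gen(2) by blast
qed

end

subsection \<open>Submodules\<close>

context module
begin

lemma submodule_zero_closed: "submodule N R M \<Longrightarrow> \<zero>\<^bsub>M\<^esub> \<in> N"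
  using subgroup.one_closed[OF submodule.axioms(1)] by fastforce

lemma submodule_gen_submodule:
  assumes "S \<subseteq> carrier M"
  shows "submodule (gen_submodule R M S) R M"
proof (rule submoduleI)
  show "gen_submodule R M S \<subseteq> carrier M"
    unfolding gen_submodule_def using carrier_is_submodule assms by blast
  show "\<zero>\<^bsub>M\<^esub> \<in> gen_submodule R M S"
    unfolding gen_submodule_def using submodule_zero_closed by blast
  show "\<ominus>\<^bsub>M\<^esub> v \<in> gen_submodule R M S" if "v \<in> gen_submodule R M S" for v
    using that submoduleE(3) unfolding gen_submodule_def by blast
  show "v \<oplus>\<^bsub>M\<^esub> w \<in> gen_submodule R M S"
    if "v \<in> gen_submodule R M S" "w \<in> gen_submodule R M S" for v w
    using that submoduleE(5) unfolding gen_submodule_def by blast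
  show "a \<odot>\<^bsub>M\<^esub> v \<in> gen_submodule R M S"
    if "a \<in> carrier R" "v \<in> gen_submodule R M S" for a v
    using that submoduleE(4) unfolding gen_submodule_def by blast
qed

lemma gen_submodule_upper: "S \<subseteq> gen_submodule R M S"
  unfolding gen_submodule_def by blast

lemma gen_submodule_least: "submodule N R M \<Longrightarrow> S \<subseteq> N \<Longrightarrow> gen_submodule R M S \<subseteq> N"
  unfolding gen_submodule_def by blast

lemma submodule_zero: "submodule {\<zero>\<^bsub>M\<^esub>} R M"
  by (rule submoduleI) auto

text \<open>Needed for two ideals in Nakayama's lemma: the whole ring gives \<open>N + R g\<close>,
  the maximal ideal gives \<open>N\<close> plus its multiples of \<open>g\<close>.\<close>

lemma submodule_add_smult:
  assumes N: "submodule N R M" and I: "ideal I R" and g: "g \<in> carrier M"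
  shows "submodule {n \<oplus>\<^bsub>M\<^esub> c \<odot>\<^bsub>M\<^esub> g |n c. n \<in> N \<and> c \<in> I} R M" (is "submodule ?K R M")
proof -
  interpret I: ideal I R by (rule I)
  note [simp] = I.Icarr subsetD[OF submoduleE(1)[OF N]]
  show ?thesis
  proof (rule submoduleI)
    show "?K \<subseteq> carrier M" using g by auto
    have "\<zero>\<^bsub>M\<^esub> = \<zero>\<^bsub>M\<^esub> \<oplus>\<^bsub>M\<^esub> \<zero> \<odot>\<^bsub>M\<^esub> g" using g by simp
    then show "\<zero>\<^bsub>M\<^esub> \<in> ?K" using submodule_zero_closed[OF N] I.zero_closed by blast
  next
    fix v assume "v \<in> ?K"
    then obtain n c where *: "v = n \<oplus>\<^bsub>M\<^esub> c \<odot>\<^bsub>M\<^esub> g" "n \<in> N" "c \<in> I" by blast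
    have "\<ominus>\<^bsub>M\<^esub> v = (\<ominus>\<^bsub>M\<^esub> n) \<oplus>\<^bsub>M\<^esub> (\<ominus> c) \<odot>\<^bsub>M\<^esub> g"
      using * g by (simp add: M.minus_add smult_l_minus)
    then show "\<ominus>\<^bsub>M\<^esub> v \<in> ?K" using * submoduleE(3)[OF N] I.a_inv_closed by blast
  next
    fix v w assume "v \<in> ?K" "w \<in> ?K"
    then obtain n c n' c' where *: "v = n \<oplus>\<^bsub>M\<^esub> c \<odot>\<^bsub>M\<^esub> g" "n \<in> N" "c \<in> I"
      "w = n' \<oplus>\<^bsub>M\<^esub> c' \<odot>\<^bsub>M\<^esub> g" "n' \<in> N" "c' \<in> I" by blast
    have "v \<oplus>\<^bsub>M\<^esub> w = (n \<oplus>\<^bsub>M\<^esub> n') \<oplus>\<^bsub>M\<^esub> (c \<oplus> c') \<odot>\<^bsub>M\<^esub> g"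
      using * g by (simp add: smult_l_distr M.a_ac)
    then show "v \<oplus>\<^bsub>M\<^esub> w \<in> ?K" using * submoduleE(5)[OF N] I.a_closed by blast
  next
    fix a v assume a: "a \<in> carrier R" and "v \<in> ?K"
    then obtain n c where *: "v = n \<oplus>\<^bsub>M\<^esub> c \<odot>\<^bsub>M\<^esub> g" "n \<in> N" "c \<in> I" by blast
    have "a \<odot>\<^bsub>M\<^esub> v = a \<odot>\<^bsub>M\<^esub> n \<oplus>\<^bsub>M\<^esub> (a \<otimes> c) \<odot>\<^bsub>M\<^esub> g"
      using * g a by (simp add: smult_r_distr smult_assoc1)
    then show "a \<odot>\<^bsub>M\<^esub> v \<in> ?K" using * a submoduleE(4)[OF N] I.I_l_closed by blast
  qed
qed

text \<open>The elements of \<open>S\<close> are adjoined to \<open>N\<close> one at a time;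
  \<open>N'\<close> is the last proper stage and \<open>g\<close> the element that completes
  it.\<close>

lemma exists_cyclic_step:
  assumes "finite S" "S \<subseteq> carrier M" "submodule N R M" "N \<noteq> carrier M"
    and "gen_submodule R M (N \<union> S) = carrier M"
  shows "\<exists>N' g. submodule N' R M \<and> N \<subseteq> N' \<and> N' \<noteq> carrier M \<and> g \<in> carrier M \<and>
    gen_submodule R M (insert g N') = carrier M"
  using assms
proof (induction S arbitrary: N rule: finite_induct)
  case empty
  then have "carrier M \<subseteq> N" using gen_submodule_least[of N N] by simp
  then show ?case using empty.prems submoduleE(1)[of N] by simp
next
  case (insert s S)
  show ?case
  proof (cases "gen_submodule R M (insert s N) = carrier M")
    case True
    then show ?thesis using insert.prems by (intro exI[of _ N] exI[of _ s]) auto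
  next
    case False
    let ?N = "gen_submodule R M (insert s N)"
    have sub: "insert s N \<subseteq> carrier M"
      using insert.prems submoduleE(1) by auto
    have N: "submodule ?N R M" by (rule submodule_gen_submodule[OF sub])
    have sub': "?N \<union> S \<subseteq> carrier M"
      using submoduleE(1)[OF N] insert.prems by auto
    have "gen_submodule R M (N \<union> insert s S) \<subseteq> gen_submodule R M (?N \<union> S)"
      using gen_submodule_upper[of "insert s N"] gen_submodule_upper[of "?N \<union> S"]
      by (intro gen_submodule_least submodule_gen_submodule[OF sub']) auto
    then have "gen_submodule R M (?N \<union> S) = carrier M"
      using insert.prems(4) submoduleE(1)[OF submodule_gen_submodule[OF sub']] by auto
    then obtain N' g where "submodule N' R M" "?N \<subseteq> N'" "N' \<noteq> carrier M" "g \<in> carrier M"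
      "gen_submodule R M (insert g N') = carrier M"
      using insert.IH[OF _ N False] insert.prems(1) by auto
    moreover have "N \<subseteq> ?N" using gen_submodule_upper[of "insert s N"] by simp
    ultimately show ?thesis
      by (intro exI[of _ N'] exI[of _ g]) simp
  qed
qed

text \<open>Reduce to \<open>M = N' + R g\<close> with \<open>N'\<close> proper, and let
  \<open>K\<close> consist of \<open>N'\<close> plus the multiples of \<open>g\<close> by the
  maximal ideal. It absorbs all products of that ideal with \<open>M\<close>.\<close>

lemma nakayama_proper_submodule:
  assumes R: "noetherian_local_ring R" and "fin_gen_module R M"
    and N: "submodule N R M" "N \<noteq> carrier M"
  obtains K where "submodule K R M" "N \<subseteq> K" "K \<noteq> carrier M"
    "\<And>a v. a \<in> max_ideal R \<Longrightarrow> v \<in> carrier M \<Longrightarrow> a \<odot>\<^bsub>M\<^esub> v \<in> K"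
proof -
  interpret R: noetherian_local_ring R by (rule R)
  interpret m: ideal "max_ideal R" R by (rule R.ideal_max_ideal)
  obtain S where S: "S \<subseteq> carrier M" "finite S" "carrier M = gen_submodule R M S"
    using assms(2) unfolding fin_gen_module_def by blast
  have "gen_submodule R M (N \<union> S) = carrier M"
  proof
    have sub: "N \<union> S \<subseteq> carrier M" using submoduleE(1)[OF N(1)] S by auto
    show "gen_submodule R M (N \<union> S) \<subseteq> carrier M"
      using sub by (intro gen_submodule_least carrier_is_submodule)
    show "carrier M \<subseteq> gen_submodule R M (N \<union> S)"
      unfolding S(3) using gen_submodule_upper[of "N \<union> S"]
      by (intro gen_submodule_least submodule_gen_submodule[OF sub]) auto
  qed
  then obtain N' g where N': "submodule N' R M" "N \<subseteq> N'" "N' \<noteq> carrier M" and g: "g \<in> carrier M"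
    and gen: "gen_submodule R M (insert g N') = carrier M"
    using exists_cyclic_step[OF S(2,1) N] by blast
  note [simp] = subsetD[OF submoduleE(1)[OF N'(1)]] m.Icarr
  let ?K = "\<lambda>I. {n \<oplus>\<^bsub>M\<^esub> c \<odot>\<^bsub>M\<^esub> g |n c. n \<in> N' \<and> c \<in> I}"
  have N'_K: "N' \<subseteq> ?K I" if "\<zero> \<in> I" for I
  proof
    fix n assume "n \<in> N'"
    moreover from this have "n = n \<oplus>\<^bsub>M\<^esub> \<zero> \<odot>\<^bsub>M\<^esub> g" using g by simp
    ultimately show "n \<in> ?K I" using that by blast
  qed
  have "g = \<zero>\<^bsub>M\<^esub> \<oplus>\<^bsub>M\<^esub> \<one> \<odot>\<^bsub>M\<^esub> g" using g by simp
  then have "g \<in> ?K (carrier R)" using submodule_zero_closed[OF N'(1)] by blast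
  then have full: "carrier M \<subseteq> ?K (carrier R)"
    unfolding gen[symmetric] using N'_K[of "carrier R"]
    by (intro gen_submodule_least submodule_add_smult N' R.oneideal g) auto
  \<comment> \<open>Otherwise \<open>(\<one> \<ominus> a) \<odot> g\<close> lies in
    \<open>N'\<close> for some \<open>a\<close> in the maximal ideal; as
    \<open>\<one> \<ominus> a\<close> is a unit, so does \<open>g\<close>.\<close>
  have "g \<notin> ?K (max_ideal R)"
  proof
    assume "g \<in> ?K (max_ideal R)"
    then obtain n a where *: "g = n \<oplus>\<^bsub>M\<^esub> a \<odot>\<^bsub>M\<^esub> g" "n \<in> N'" "a \<in> max_ideal R" by blast
    have ac: "a \<in> carrier R" using * by simp
    have "\<one> \<ominus> a \<notin> max_ideal R"
    proof
      assume "\<one> \<ominus> a \<in> max_ideal R"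
      then have "\<one> \<ominus> a \<oplus> a \<in> max_ideal R" using * by (intro m.a_closed)
      moreover have "\<one> \<ominus> a \<oplus> a = \<one>" using ac by algebra
      ultimately show False
        using R.primeideal_one_notin[OF R.primeideal_max_ideal] by simp
    qed
    then have U: "\<one> \<ominus> a \<in> Units R"
      using R.notin_max_ideal_Units ac by simp
    have "(\<one> \<ominus> a) \<odot>\<^bsub>M\<^esub> g = g \<oplus>\<^bsub>M\<^esub> \<ominus>\<^bsub>M\<^esub> (a \<odot>\<^bsub>M\<^esub> g)"
      using ac g by (simp add: R.minus_eq smult_l_distr smult_l_minus)
    also have "\<dots> = n"
      using * ac g by (simp add: M.add.inv_solve_right')
    finally have "inv (\<one> \<ominus> a) \<odot>\<^bsub>M\<^esub> ((\<one> \<ominus> a) \<odot>\<^bsub>M\<^esub> g) \<in> N'"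
      using *(2) U by (simp add: submoduleE(4)[OF N'(1)])
    then have "g \<in> N'"
      using U ac g by (simp add: smult_assoc1[symmetric])
    then have "carrier M \<subseteq> N'"
      unfolding gen[symmetric] by (intro gen_submodule_least N') auto
    then show False using N' submoduleE(1)[OF N'(1)] by blast
  qed
  moreover have "a \<odot>\<^bsub>M\<^esub> v \<in> ?K (max_ideal R)" if a: "a \<in> max_ideal R" and "v \<in> carrier M" for a v
  proof -
    obtain n c where *: "v = n \<oplus>\<^bsub>M\<^esub> c \<odot>\<^bsub>M\<^esub> g" "n \<in> N'" "c \<in> carrier R"
      using full \<open>v \<in> carrier M\<close> by blast
    have "a \<odot>\<^bsub>M\<^esub> v = a \<odot>\<^bsub>M\<^esub> n \<oplus>\<^bsub>M\<^esub> (a \<otimes> c) \<odot>\<^bsub>M\<^esub> g"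
      using * g a by (simp add: smult_r_distr smult_assoc1)
    then show ?thesis
      using * a submoduleE(4)[OF N'(1), of a n] m.I_r_closed[of a c] m.Icarr[OF a] by blast
  qed
  moreover have "N \<subseteq> ?K (max_ideal R)" using N'_K[of "max_ideal R"] N' by auto
  ultimately show ?thesis
    using that submodule_add_smult[OF N'(1) R.ideal_max_ideal g] g by blast
qed

end

subsection \<open>Ideals of the idealization\<close>

lemma idealization_simps [simp]:
  "carrier (idealization R M) = carrier R \<times> carrier M"
  "\<zero>\<^bsub>idealization R M\<^esub> = (\<zero>\<^bsub>R\<^esub>, \<zero>\<^bsub>M\<^esub>)"
  "\<one>\<^bsub>idealization R M\<^esub> = (\<one>\<^bsub>R\<^esub>, \<zero>\<^bsub>M\<^esub>)"
  "(a, v) \<oplus>\<^bsub>idealization R M\<^esub> (b, w) = (a \<oplus>\<^bsub>R\<^esub> b, v \<oplus>\<^bsub>M\<^esub> w)"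
  "(a, v) \<otimes>\<^bsub>idealization R M\<^esub> (b, w) = (a \<otimes>\<^bsub>R\<^esub> b, a \<odot>\<^bsub>M\<^esub> w \<oplus>\<^bsub>M\<^esub> b \<odot>\<^bsub>M\<^esub> v)"
  by (simp_all add: idealization_def)

context module
begin

abbreviation "A \<equiv> idealization R M"

lemma ideal_Times:
  assumes I: "ideal I R" and N: "submodule N R M"
    and IN: "\<And>a v. a \<in> I \<Longrightarrow> v \<in> carrier M \<Longrightarrow> a \<odot>\<^bsub>M\<^esub> v \<in> N"
  shows "ideal (I \<times> N) A"
proof (rule cring.idealI_cring[OF idealization_cring])
  interpret I: ideal I R by (rule I)
  note [simp] = subsetD[OF submoduleE(1)[OF N]]
  show "I \<times> N \<subseteq> carrier A" using I.Icarr by auto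
  show "\<zero>\<^bsub>A\<^esub> \<in> I \<times> N" using submodule_zero_closed[OF N] by simp
  show "x \<oplus>\<^bsub>A\<^esub> y \<in> I \<times> N" if "x \<in> I \<times> N" "y \<in> I \<times> N" for x y
    using that submoduleE(5)[OF N] by auto
  show "x \<otimes>\<^bsub>A\<^esub> y \<in> I \<times> N" if "x \<in> carrier A" "y \<in> I \<times> N" for x y
    using that I.I_l_closed IN submoduleE(4,5)[OF N] by auto
qed

lemma ideal_idealization_closed:
  assumes "ideal J A"
  shows "(\<zero>, \<zero>\<^bsub>M\<^esub>) \<in> J"
    and "(a, v) \<in> J \<Longrightarrow> (b, w) \<in> J \<Longrightarrow> (a \<oplus> b, v \<oplus>\<^bsub>M\<^esub> w) \<in> J"
    and "b \<in> carrier R \<Longrightarrow> w \<in> carrier M \<Longrightarrow> (a, v) \<in> J \<Longrightarrow>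
      (b \<otimes> a, b \<odot>\<^bsub>M\<^esub> v \<oplus>\<^bsub>M\<^esub> a \<odot>\<^bsub>M\<^esub> w) \<in> J"
proof -
  interpret J: ideal J A by (rule assms)
  show "(\<zero>, \<zero>\<^bsub>M\<^esub>) \<in> J"
    using additive_subgroup.zero_closed[OF J.is_additive_subgroup] unfolding idealization_simps .
  show "(a \<oplus> b, v \<oplus>\<^bsub>M\<^esub> w) \<in> J" if "(a, v) \<in> J" "(b, w) \<in> J"
    using additive_subgroup.a_closed[OF J.is_additive_subgroup that] unfolding idealization_simps .
  show "(b \<otimes> a, b \<odot>\<^bsub>M\<^esub> v \<oplus>\<^bsub>M\<^esub> a \<odot>\<^bsub>M\<^esub> w) \<in> J"
    if "b \<in> carrier R" "w \<in> carrier M" "(a, v) \<in> J"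
    using J.I_l_closed[OF that(3), of "(b, w)"] that(1,2) by simp
qed

lemma ideal_fst:
  assumes "ideal J A"
  shows "ideal {r \<in> carrier R. (r, \<zero>\<^bsub>M\<^esub>) \<in> J} R" (is "ideal ?I R")
proof (rule R.idealI_cring)
  note J = ideal_idealization_closed[OF assms]
  show "\<zero> \<in> ?I" using J(1) by simp
  show "x \<oplus> y \<in> ?I" if "x \<in> ?I" "y \<in> ?I" for x y
    using that J(2)[of x "\<zero>\<^bsub>M\<^esub>" y "\<zero>\<^bsub>M\<^esub>"] by simp
  show "a \<otimes> x \<in> ?I" if "a \<in> carrier R" "x \<in> ?I" for a x
    using that J(3)[of a "\<zero>\<^bsub>M\<^esub>" x "\<zero>\<^bsub>M\<^esub>"] by simp
qed auto

lemma submodule_snd: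
  assumes "ideal J A"
  shows "submodule {v \<in> carrier M. (\<zero>, v) \<in> J} R M" (is "submodule ?N R M")
proof -
  note J = ideal_idealization_closed[OF assms]
  have smult: "a \<odot>\<^bsub>M\<^esub> v \<in> ?N" if "a \<in> carrier R" "v \<in> ?N" for a v
    using that J(3)[of a "\<zero>\<^bsub>M\<^esub>" \<zero> v] by simp
  show ?thesis
  proof (rule submoduleI)
    show "\<zero>\<^bsub>M\<^esub> \<in> ?N" using J(1) by simp
    show "\<ominus>\<^bsub>M\<^esub> v \<in> ?N" if "v \<in> ?N" for v
      using smult[of "\<ominus> \<one>" v] that by (simp add: smult_l_minus)
    show "v \<oplus>\<^bsub>M\<^esub> w \<in> ?N" if "v \<in> ?N" "w \<in> ?N" for v w
      using that J(2)[of \<zero> v \<zero> w] by simp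
  qed (use smult in auto)
qed

lemma mem_ideal_iff:
  assumes J: "ideal J A" and M: "\<And>v. v \<in> carrier M \<Longrightarrow> (\<zero>, v) \<in> J"
    and r: "r \<in> carrier R" and v: "v \<in> carrier M"
  shows "(r, v) \<in> J \<longleftrightarrow> (r, \<zero>\<^bsub>M\<^esub>) \<in> J"
proof
  note add = ideal_idealization_closed(2)[OF J]
  show "(r, \<zero>\<^bsub>M\<^esub>) \<in> J" if "(r, v) \<in> J"
    using add[OF that M[of "\<ominus>\<^bsub>M\<^esub> v"]] r v by (simp add: M.r_neg)
  show "(r, v) \<in> J" if "(r, \<zero>\<^bsub>M\<^esub>) \<in> J"
    using add[OF that M[OF v]] r v by simp
qed

section \<open>Primes and Krull dimension of the idealization\<close>

lemma primeideal_Times: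
  assumes "primeideal P R"
  shows "primeideal (P \<times> carrier M) A"
proof (rule primeidealI)
  interpret P: primeideal P R by (rule assms)
  show "ideal (P \<times> carrier M) A"
    using P.Icarr by (intro ideal_Times P.is_ideal carrier_is_submodule) auto
  show "cring A" by (rule idealization_cring)
  show "carrier A \<noteq> P \<times> carrier M"
    using R.primeideal_one_notin[OF assms] by auto
  show "x \<in> P \<times> carrier M \<or> y \<in> P \<times> carrier M"
    if "x \<in> carrier A" "y \<in> carrier A" "x \<otimes>\<^bsub>A\<^esub> y \<in> P \<times> carrier M" for x y
    using that P.I_prime[of "fst x" "fst y"] by (cases x; cases y) simp
qed

lemma primeideal_idealizationE:
  assumes "primeideal P A"
  obtains p where "primeideal p R" "P = p \<times> carrier M"
proof -
  interpret P: primeideal P A by (rule assms)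
  let ?p = "{r \<in> carrier R. (r, \<zero>\<^bsub>M\<^esub>) \<in> P}"
  have M_P: "(\<zero>, v) \<in> P" if "v \<in> carrier M" for v
    using that P.I_prime[of "(\<zero>, v)" "(\<zero>, v)"] ideal_idealization_closed(1)[OF P.is_ideal] by simp
  have "P \<subseteq> carrier A" using P.Icarr by blast
  then have P_eq: "P = ?p \<times> carrier M"
    using mem_ideal_iff[OF P.is_ideal M_P] by auto
  have "primeideal ?p R"
  proof (rule primeidealI)
    show "ideal ?p R" by (rule ideal_fst[OF P.is_ideal])
    show "cring R" by (rule R.cring_axioms)
    have "(\<one>, \<zero>\<^bsub>M\<^esub>) \<notin> P"
      using cring.primeideal_one_notin[OF idealization_cring assms] by simp
    then show "carrier R \<noteq> ?p" by auto
    show "a \<in> ?p \<or> b \<in> ?p" if "a \<in> carrier R" "b \<in> carrier R" "a \<otimes> b \<in> ?p" for a b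
      using that P.I_prime[of "(a, \<zero>\<^bsub>M\<^esub>)" "(b, \<zero>\<^bsub>M\<^esub>)"] by auto
  qed
  then show ?thesis using that P_eq by blast
qed

lemma krull_dim_idealization: "krull_dim A = krull_dim R"
proof (rule antisym)
  show "krull_dim A \<le> krull_dim R"
    unfolding krull_dim_def[of A]
  proof (rule Sup_least, clarify)
    fix n and C :: "nat \<Rightarrow> ('a \<times> 'c) set"
    assume C: "\<forall>i\<le>n. primeideal (C i) A" "\<forall>i<n. C i \<subset> C (Suc i)"
    then have "\<forall>i\<le>n. \<exists>p. primeideal p R \<and> C i = p \<times> carrier M"
      using primeideal_idealizationE by metis
    then obtain p where p: "\<And>i. i \<le> n \<Longrightarrow> primeideal (p i) R \<and> C i = p i \<times> carrier M"
      by metis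
    show "enat n \<le> krull_dim R"
    proof (rule krull_dim_ge)
      show "primeideal (p i) R" if "i \<le> n" for i using p that by blast
      show "p i \<subset> p (Suc i)" if "i < n" for i
      proof -
        have "C i \<subset> C (Suc i)" using C(2) that by simp
        then show ?thesis using p[of i] p[of "Suc i"] that M.zero_closed by auto
      qed
    qed
  qed
  show "krull_dim R \<le> krull_dim A"
    unfolding krull_dim_def[of R]
  proof (rule Sup_least, clarify)
    fix n and C :: "nat \<Rightarrow> 'a set"
    assume C: "\<forall>i\<le>n. primeideal (C i) R" "\<forall>i<n. C i \<subset> C (Suc i)"
    have "C i \<times> carrier M \<subset> C (Suc i) \<times> carrier M" if "i < n" for i
    proof -
      have "C i \<subset> C (Suc i)" using C that by simp
      then show ?thesis using M.zero_closed by blast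
    qed
    then show "enat n \<le> krull_dim A"
      using C primeideal_Times by (intro krull_dim_ge[of n "\<lambda>i. C i \<times> carrier M"]) auto
  qed
qed

text \<open>Each ring property assumed of \<open>A\<close> in the theorem includes locality, so it
  suffices to exhibit one maximal ideal. An ideal above this one contains every
  \<open>(\<zero>, v)\<close> and is determined by its first components.\<close>

lemma max_ideal_idealization:
  assumes R: "noetherian_local_ring R" and A: "local_ring A"
  shows "max_ideal A = max_ideal R \<times> carrier M"
proof (rule local_ring.max_ideal_eqI[OF A])
  interpret R: noetherian_local_ring R by (rule R)
  interpret m: maximalideal "max_ideal R" R by (rule R.maximalideal_max_ideal)
  show "maximalideal (max_ideal R \<times> carrier M) A"
  proof (rule maximalidealI)
    show "ideal (max_ideal R \<times> carrier M) A"
      using m.Icarr by (intro ideal_Times m.is_ideal carrier_is_submodule) auto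
    show "carrier A \<noteq> max_ideal R \<times> carrier M"
      using R.primeideal_one_notin[OF R.primeideal_max_ideal] by auto
  next
    fix J assume J: "ideal J A" "max_ideal R \<times> carrier M \<subseteq> J" "J \<subseteq> carrier A"
    let ?j = "{r \<in> carrier R. (r, \<zero>\<^bsub>M\<^esub>) \<in> J}"
    have M_J: "(\<zero>, v) \<in> J" if "v \<in> carrier M" for v
      using J(2) that m.zero_closed by blast
    have J_eq: "J = ?j \<times> carrier M"
      using mem_ideal_iff[OF J(1) M_J] J(3) by auto
    have "max_ideal R \<subseteq> ?j"
      using J(2) m.Icarr by auto
    then have "?j = max_ideal R \<or> ?j = carrier R"
      using m.I_maximal[OF ideal_fst[OF J(1)]] by blast
    then show "J = max_ideal R \<times> carrier M \<or> J = carrier A"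
      using J_eq by auto
  qed
qed

section \<open>Embedding dimension of the idealization\<close>

lemma edim_le_card_idealization:
  assumes R: "noetherian_local_ring R"
    and T: "T \<subseteq> {\<zero>} \<times> carrier M" and S: "finite S" "S \<subseteq> carrier A"
    and gen: "Idl\<^bsub>A\<^esub> (T \<union> S) = max_ideal R \<times> carrier M"
  shows "edim R \<le> card S"
proof -
  interpret R: noetherian_local_ring R by (rule R)
  interpret A: cring A by (rule idealization_cring)
  have TS: "T \<union> S \<subseteq> carrier A" using T S by auto
  have S_m: "fst ` S \<subseteq> max_ideal R"
    using A.genideal_self[OF TS] gen by auto
  have sub: "fst ` S \<subseteq> carrier R" using S by auto
  interpret I: ideal "Idl (fst ` S)" R by (rule R.genideal_ideal[OF sub])
  \<comment> \<open>The elements of \<open>T\<close> have first component zero and lie in this ideal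
    for free, so \<open>S\<close> alone has to account for the maximal ideal of
    \<open>R\<close>.\<close>
  have "Idl\<^bsub>A\<^esub> (T \<union> S) \<subseteq> (Idl (fst ` S)) \<times> carrier M"
  proof (rule A.genideal_minimal)
    show "ideal ((Idl (fst ` S)) \<times> carrier M) A"
      using I.Icarr by (intro ideal_Times I.is_ideal carrier_is_submodule) auto
    show "T \<union> S \<subseteq> (Idl (fst ` S)) \<times> carrier M"
      using T S R.genideal_self[OF sub] by fastforce
  qed
  then have "max_ideal R \<subseteq> Idl (fst ` S)"
    using gen M.zero_closed by blast
  then have "max_ideal R = Idl (fst ` S)"
    using R.genideal_minimal[OF R.ideal_max_ideal S_m] by blast
  then have "edim R \<le> card (fst ` S)"
    using S by (intro edim_le_card sub) auto
  also have "\<dots> \<le> card S" using S by (intro card_image_le)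
  finally show ?thesis .
qed

text \<open>The exchange is taken modulo \<open>max_ideal R \<times> K\<close> with \<open>K\<close>
  from Nakayama's lemma. It contains products of elements of the maximal ideal of \<open>A\<close>,
  because their second components lie in \<open>K\<close>, and it contains \<open>T\<close>, because
  \<open>K\<close> contains \<open>N\<close>. Any \<open>u\<close> outside \<open>K\<close> can
  enter.\<close>

lemma idealization_exchange:
  assumes R: "noetherian_local_ring R" and fg: "fin_gen_module R M"
    and A: "noetherian_local_ring A"
    and N: "submodule N R M" "N \<noteq> carrier M"
    and T: "T \<subseteq> {\<zero>} \<times> N" and S: "finite S" "S \<subseteq> carrier A"
    and gen: "Idl\<^bsub>A\<^esub> (T \<union> S) = max_ideal R \<times> carrier M"
  obtains s u where "s \<in> S" "u \<in> carrier M"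
    "Idl\<^bsub>A\<^esub> (insert (\<zero>, u) T \<union> (S - {s})) = max_ideal R \<times> carrier M"
proof -
  interpret R: noetherian_local_ring R by (rule R)
  interpret A: noetherian_local_ring A by (rule A)
  interpret m: ideal "max_ideal R" R by (rule R.ideal_max_ideal)
  have max_A: "max_ideal A = max_ideal R \<times> carrier M"
    by (rule max_ideal_idealization[OF R A.local_ring_axioms])
  obtain K where K: "submodule K R M" "N \<subseteq> K" "K \<noteq> carrier M"
    and mK: "\<And>a v. a \<in> max_ideal R \<Longrightarrow> v \<in> carrier M \<Longrightarrow> a \<odot>\<^bsub>M\<^esub> v \<in> K"
    using nakayama_proper_submodule[OF R fg N] by blast
  obtain u where u: "u \<in> carrier M" "u \<notin> K"
    using K submoduleE(1)[OF K(1)] by blast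
  have sub: "T \<union> S \<subseteq> carrier A"
    using T S submoduleE(1)[OF N(1)] by auto
  obtain s where "s \<in> S" "Idl\<^bsub>A\<^esub> (insert (\<zero>, u) T \<union> (S - {s})) = max_ideal A"
  proof (rule A.max_ideal_exchange[OF S(1) sub])
    show "Idl\<^bsub>A\<^esub> (T \<union> S) = max_ideal A" using gen max_A by simp
    show "ideal (max_ideal R \<times> K) A"
      using mK by (intro ideal_Times m.is_ideal K(1))
    show "x \<otimes>\<^bsub>A\<^esub> y \<in> max_ideal R \<times> K" if "x \<in> max_ideal A" "y \<in> max_ideal A" for x y
      using that mK submoduleE(5)[OF K(1)] m.I_l_closed m.Icarr unfolding max_A by auto
    show "T \<subseteq> max_ideal R \<times> K" using T K(2) m.zero_closed by blast
    show "(\<zero>, u) \<in> max_ideal A" "(\<zero>, u) \<notin> max_ideal R \<times> K"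
      using u m.zero_closed by (auto simp: max_A)
  qed (use that in auto)
  then show ?thesis using that u max_A by simp
qed

lemma edim_idealization_lower:
  assumes R: "noetherian_local_ring R" and fg: "fin_gen_module R M"
    and A: "noetherian_local_ring A" and M: "carrier M \<noteq> {\<zero>\<^bsub>M\<^esub>}"
  shows "edim R + 1 \<le> edim A" "\<not> cyclic_module R M \<Longrightarrow> edim R + 2 \<le> edim A"
proof -
  interpret A: noetherian_local_ring A by (rule A)
  have max_A: "max_ideal A = max_ideal R \<times> carrier M"
    by (rule max_ideal_idealization[OF R A.local_ring_axioms])
  obtain S where S: "S \<subseteq> carrier A" "finite S" "card S = edim A" "Idl\<^bsub>A\<^esub> S = max_ideal A"
    by (rule A.edim_generators)
  obtain s u where s: "s \<in> S" and u: "u \<in> carrier M"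
    and gen: "Idl\<^bsub>A\<^esub> ({(\<zero>, u)} \<union> (S - {s})) = max_ideal R \<times> carrier M"
    by (rule idealization_exchange[OF R fg A submodule_zero, of "{}" S]) (use S M max_A in auto)
  have "edim R \<le> card (S - {s})"
    by (rule edim_le_card_idealization[OF R _ _ _ gen]) (use S u in auto)
  then show "edim R + 1 \<le> edim A"
    using S s by (metis Suc_eq_plus1 card_Suc_Diff1 Suc_le_mono)
  assume "\<not> cyclic_module R M"
  then have proper: "gen_submodule R M {u} \<noteq> carrier M"
    using u unfolding cyclic_module_def by auto
  \<comment> \<open>Now \<open>N = R u\<close>, so that the element \<open>(\<zero>, u)\<close> from
    the first exchange stays in \<open>T\<close>.\<close>
  obtain s' v where s': "s' \<in> S - {s}" and v: "v \<in> carrier M"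
    and gen': "Idl\<^bsub>A\<^esub> (insert (\<zero>, v) {(\<zero>, u)} \<union> (S - {s} - {s'})) = max_ideal R \<times> carrier M"
    by (rule idealization_exchange[OF R fg A submodule_gen_submodule proper _ _ _ gen])
      (use S u gen_submodule_upper[of "{u}"] in auto)
  have "edim R \<le> card (S - {s} - {s'})"
    by (rule edim_le_card_idealization[OF R _ _ _ gen']) (use S u v in auto)
  moreover have "card (S - {s} - {s'}) + 2 = card S"
    using S s s' card_Suc_Diff1[of S s] card_Suc_Diff1[of "S - {s}" s'] by simp
  ultimately show "edim R + 2 \<le> edim A" using S by simp
qed

text \<open>Lift a minimal generating set of the maximal ideal of \<open>R\<close> and add
  \<open>(\<zero>, u)\<close>, where \<open>u\<close> generates \<open>M\<close>. The multiples of
  \<open>(\<zero>, u)\<close> supply every \<open>(\<zero>, v)\<close>.\<close>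

lemma edim_idealization_upper:
  assumes R: "noetherian_local_ring R" and A: "local_ring A" and "cyclic_module R M"
  shows "edim A \<le> edim R + 1"
proof -
  interpret R: noetherian_local_ring R by (rule R)
  interpret A: cring A by (rule idealization_cring)
  obtain u where u: "u \<in> carrier M" and gen: "carrier M = gen_submodule R M {u}"
    using assms(3) unfolding cyclic_module_def by blast
  obtain S where S: "S \<subseteq> carrier R" "finite S" "card S = edim R" "Idl S = max_ideal R"
    by (rule R.edim_generators)
  let ?G = "insert (\<zero>, u) ((\<lambda>s. (s, \<zero>\<^bsub>M\<^esub>)) ` S)"
  have G: "?G \<subseteq> carrier A" using S u by auto
  interpret G: ideal "Idl\<^bsub>A\<^esub> ?G" A by (rule A.genideal_ideal[OF G])
  have "carrier M \<subseteq> {v \<in> carrier M. (\<zero>, v) \<in> Idl\<^bsub>A\<^esub> ?G}"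
    unfolding gen using u gen A.genideal_self[OF G]
    by (intro gen_submodule_least submodule_snd[OF G.is_ideal, unfolded gen]) auto
  then have M_G: "(\<zero>, v) \<in> Idl\<^bsub>A\<^esub> ?G" if "v \<in> carrier M" for v
    using that by blast
  have m_G: "max_ideal R \<subseteq> {r \<in> carrier R. (r, \<zero>\<^bsub>M\<^esub>) \<in> Idl\<^bsub>A\<^esub> ?G}"
    unfolding S(4)[symmetric] using A.genideal_self[OF G] S(1)
    by (intro R.genideal_minimal ideal_fst[OF G.is_ideal]) auto
  have "max_ideal R \<times> carrier M \<subseteq> Idl\<^bsub>A\<^esub> ?G"
    using mem_ideal_iff[OF G.is_ideal M_G] m_G by auto
  moreover have "Idl\<^bsub>A\<^esub> ?G \<subseteq> max_ideal R \<times> carrier M"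
  proof (rule A.genideal_minimal)
    show "ideal (max_ideal R \<times> carrier M) A"
      using ideal.Icarr[OF R.ideal_max_ideal]
      by (intro ideal_Times R.ideal_max_ideal carrier_is_submodule) auto
    show "?G \<subseteq> max_ideal R \<times> carrier M"
      using R.genideal_self[OF S(1)] S(4) u
        additive_subgroup.zero_closed[OF ideal.axioms(1)[OF R.ideal_max_ideal]] by auto
  qed
  ultimately have "max_ideal A = Idl\<^bsub>A\<^esub> ?G"
    using max_ideal_idealization[OF R A] by simp
  then have "edim A \<le> card ?G"
    using S G by (intro edim_le_card) auto
  also have "\<dots> \<le> Suc (card ((\<lambda>s. (s, \<zero>\<^bsub>M\<^esub>)) ` S))"
    by (rule card_insert_le_m1) auto
  also have "\<dots> \<le> edim R + 1"
    using S card_image_le[of S "\<lambda>s. (s, \<zero>\<^bsub>M\<^esub>)"] by simp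
  finally show ?thesis .
qed

end

theorem theorem4p4:
  fixes R :: "('a, 'c) ring_scheme" and M :: "('a, 'b, 'd) module_scheme"
  assumes "noetherian_local_ring R"
    and "module R M"
    and "fin_gen_module R M"
    and "carrier M \<noteq> {\<zero>\<^bsub>M\<^esub>}"
  shows "\<not> regular_local_ring (idealization R M) \<and>
    (hypersurface_ring (idealization R M) \<longrightarrow> cyclic_module R M \<and> regular_local_ring R) \<and>
    (cohen_macaulay_local_ring (idealization R M) \<and> cyclic_module R M \<and> regular_local_ring R
      \<longrightarrow> hypersurface_ring (idealization R M))"
proof (intro conjI impI)
  interpret R: noetherian_local_ring R by (rule assms(1))
  interpret module R M by (rule assms(2))
  note dim = krull_dim_idealization R.krull_dim_le_edim
  note lower = edim_idealization_lower[OF assms(1,3) _ assms(4)]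
  show "\<not> regular_local_ring A"
  proof
    assume "regular_local_ring A"
    then interpret A: regular_local_ring A .
    have "enat (edim A) \<le> enat (edim R)"
      using A.edim_eq_krull_dim dim by simp
    then show False
      using lower(1)[OF A.noetherian_local_ring_axioms] by simp
  qed
  {
    assume "hypersurface_ring A"
    then interpret A: hypersurface_ring A .
    note A = A.noetherian_local_ring_axioms
    have edim_A: "enat (edim A) \<le> krull_dim R + 1"
      using A.edim_le_depth A.depth_le_krull_dim dim(1) by (metis add_right_mono order_trans)
    \<comment> \<open>The bound by \<open>edim R\<close> makes the dimension finite, so the
      estimates can be compared as natural numbers.\<close>
    obtain d where d: "krull_dim R = enat d" "d \<le> edim R"
      using dim(2) by (cases "krull_dim R") auto
    have "edim A \<le> d + 1" using edim_A d by (simp add: one_enat_def)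
    show "cyclic_module R M"
      using lower(2)[OF A] \<open>edim A \<le> d + 1\<close> d by linarith
    have "edim R = d"
      using lower(1)[OF A] \<open>edim A \<le> d + 1\<close> d by simp
    then show "regular_local_ring R"
      using d by unfold_locales simp
  }
  assume *: "cohen_macaulay_local_ring A \<and> cyclic_module R M \<and> regular_local_ring R"
  then interpret A: cohen_macaulay_local_ring A by blast
  have "edim A \<le> edim R + 1"
    using edim_idealization_upper[OF assms(1) A.local_ring_axioms] * by blast
  then have "enat (edim A) \<le> enat (edim R) + 1"
    by (simp add: one_enat_def)
  \<comment> \<open>Regularity of \<open>R\<close>, equality of the dimensions and the
    Cohen-Macaulay property of \<open>A\<close> are combined here.\<close>
  also have "enat (edim R) = depth A"
    using regular_local_ring.edim_eq_krull_dim[of R] * dim(1) A.depth_eq_krull_dim by simp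
  finally show "hypersurface_ring A" by unfold_locales
qed

end
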